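(* Let $c_1>0$, $c_2>0$ with $c_1+c_2\le\sqrt2$, let $0<x_L<x_R<\pi$, $\rho_x\ge0$, $\rho_u\ge0$. For $N\in\mathbb{N}$ ($N\ge1$), call $\gamma>0$ achievable with $N$ modes if the denominators of $\rho_n$ for $N+1\le n\le M$ and of $C_M$ (defined in the context, with $M=M(N)$) are positive and there exists a symmetric positive definite $P\in\mathbb{R}^{2N\times2N}$ satisfying $$PA+A^\top P-P(BR^{-1}B^\top-\gamma^{-2}EE^\top)P+C^\top C=0,$$ where $R=\rho_u+\rho_\infty$, $A,B,C,E$ and $\rho_\infty$ being the matrices and the number defined in the context for this $N$ and $\gamma$. If $\gamma>0$ is achievable with $N$ modes, then $\gamma$ is achievable with $N+1$ modes. That is, when $N$ grows, the guaranteed $L^2$ gain $\gamma$ can only decrease.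
   Context: For $n\in\mathbb{N}$ let $$\omega_n=n^2,\quad \zeta_n=\tfrac12(c_1\omega_n^{-1}+c_2\omega_n),\quad b_n=n\sqrt{2/\pi}\,(\cos nx_R-\cos nx_L),$$ $$\rho_n=\begin{cases}\dfrac{b_n^2(1+\rho_x\omega_n^2)}{4\omega_n^4\zeta_n^2(1-\zeta_n^2)-(1+\rho_x\omega_n^2)\gamma^{-2}},&2\zeta_n^2\le1,\\[2mm] \dfrac{b_n^2(1+\rho_x\omega_n^2)}{\omega_n^4-(1+\rho_x\omega_n^2)\gamma^{-2}},&2\zeta_n^2>1.\end{cases}$$ For given $N$ and $\gamma$ let $$M=M(N)=\max\left\{N,\left\lfloor\sqrt{\frac{1+\sqrt{1-2c_1c_2}}{\sqrt2\,c_2}}\right\rfloor\right\},\qquad C_M=\frac{\omega_{M+1}^2(1+\rho_x\omega_{M+1}^2)}{\omega_{M+1}^4-(1+\rho_x\omega_{M+1}^2)\gamma^{-2}},$$ $$\rho_\infty=\sum_{n=N+1}^M\rho_n+C_M\left[|x_R-x_L|-\sum_{n=1}^M\frac{b_n^2}{\omega_n^2}\right],$$ where $\lfloor\cdot\rfloor$ is the integer part. With $\Omega_N=\operatorname{diag}\{\omega_1,\dots,\omega_N\}$, $$A=\begin{bmatrix}0_N & I_N \\ -\Omega_N^2 & -(c_1I_N+c_2\Omega_N^2)\end{bmatrix},\quad B=[0,\dots,0,b_1,\dots,b_N]^\top\in\mathbb{R}^{2N},\quad E=\begin{bmatrix}0_N \\ I_N\end{bmatrix},$$ $$C=\begin{bmatrix}\sqrt{I_N+\rho_x\Omega_N^2}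 & 0_{N\times N} \\ 0_{1\times N} & 0_{1\times N}\end{bmatrix}.$$ These matrices come from the modal decomposition $\ddot z_n+2\zeta_n\omega_n\dot z_n+\omega_n^2z_n=b_nu+w_n$ of the Euler--Bernoulli beam $z_{tt}+z_{xxxx}+c_1z_t+c_2z_{xxxxt}=[\delta'(x-x_L)-\delta'(x-x_R)]u+w$ on $[0,\pi]$ with hinged ends. An achievable $\gamma$ is the guaranteed bound on the $L^2$ gain under the feedback $u=-R^{-1}B^\top P[z_1,\dots,z_N,\dot z_1,\dots,\dot z_N]^\top$. *)

theory Defs
  imports Complex_Main "Jordan_Normal_Form.Matrix"
begin

text \<open>Mode numbers \<open>n\<close> start at 1, whereas matrix indices start at 0, so index \<open>i\<close> carries mode \<open>i + 1\<close>.\<close>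

definition omega :: "nat \<Rightarrow> real" where
  "omega n = (real n)\<^sup>2"

definition zeta :: "real \<Rightarrow> real \<Rightarrow> nat \<Rightarrow> real" where
  "zeta c1 c2 n = (c1 * inverse (omega n) + c2 * omega n) / 2"

definition bcoef :: "real \<Rightarrow> real \<Rightarrow> nat \<Rightarrow> real" where
  "bcoef xL xR n = real n * sqrt (2 / pi) * (cos (real n * xR) - cos (real n * xL))"

definition rho_denom :: "real \<Rightarrow> real \<Rightarrow> real \<Rightarrow> real \<Rightarrow> nat \<Rightarrow> real" where
  "rho_denom c1 c2 \<rho>x \<gamma> n =
     (if 2 * (zeta c1 c2 n)\<^sup>2 \<le> 1
      then 4 * omega n ^ 4 * (zeta c1 c2 n)\<^sup>2 * (1 - (zeta c1 c2 n)\<^sup>2)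
             - (1 + \<rho>x * (omega n)\<^sup>2) * inverse (\<gamma>\<^sup>2)
      else omega n ^ 4 - (1 + \<rho>x * (omega n)\<^sup>2) * inverse (\<gamma>\<^sup>2))"

definition rho :: "real \<Rightarrow> real \<Rightarrow> real \<Rightarrow> real \<Rightarrow> real \<Rightarrow> real \<Rightarrow> nat \<Rightarrow> real" where
  "rho c1 c2 xL xR \<rho>x \<gamma> n =
     (bcoef xL xR n)\<^sup>2 * (1 + \<rho>x * (omega n)\<^sup>2) / rho_denom c1 c2 \<rho>x \<gamma> n"

definition Mnum :: "real \<Rightarrow> real \<Rightarrow> nat \<Rightarrow> nat" where
  "Mnum c1 c2 N = max N (nat \<lfloor>sqrt ((1 + sqrt (1 - 2 * c1 * c2)) / (sqrt 2 * c2))\<rfloor>)"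

definition CM_denom :: "real \<Rightarrow> real \<Rightarrow> nat \<Rightarrow> real" where
  "CM_denom \<rho>x \<gamma> M =
     omega (M + 1) ^ 4 - (1 + \<rho>x * (omega (M + 1))\<^sup>2) * inverse (\<gamma>\<^sup>2)"

definition CM :: "real \<Rightarrow> real \<Rightarrow> nat \<Rightarrow> real" where
  "CM \<rho>x \<gamma> M =
     (omega (M + 1))\<^sup>2 * (1 + \<rho>x * (omega (M + 1))\<^sup>2) / CM_denom \<rho>x \<gamma> M"

definition rho_inf :: "real \<Rightarrow> real \<Rightarrow> real \<Rightarrow> real \<Rightarrow> real \<Rightarrow> real \<Rightarrow> nat \<Rightarrow> real" where
  "rho_inf c1 c2 xL xR \<rho>x \<gamma> N =
     (let M = Mnum c1 c2 N in
        (\<Sum>n = N + 1..M. rho c1 c2 xL xR \<rho>x \<gamma> n)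
        + CM \<rho>x \<gamma> M * (\<bar>xR - xL\<bar> - (\<Sum>n = 1..M. (bcoef xL xR n)\<^sup>2 / (omega n)\<^sup>2)))"

definition Omega_mat :: "nat \<Rightarrow> real mat" where
  "Omega_mat N = mat_diag N (\<lambda>i. omega (i + 1))"

definition A_mat :: "real \<Rightarrow> real \<Rightarrow> nat \<Rightarrow> real mat" where
  "A_mat c1 c2 N =
     four_block_mat (0\<^sub>m N N) (1\<^sub>m N)
       (- (Omega_mat N ^\<^sub>m 2)) (- (c1 \<cdot>\<^sub>m 1\<^sub>m N + c2 \<cdot>\<^sub>m (Omega_mat N ^\<^sub>m 2)))"

definition B_mat :: "real \<Rightarrow> real \<Rightarrow> nat \<Rightarrow> real mat" where
  "B_mat xL xR N = 0\<^sub>m N 1 @\<^sub>r mat N 1 (\<lambda>(i, j). bcoef xL xR (i + 1))"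

definition E_mat :: "nat \<Rightarrow> real mat" where
  "E_mat N = 0\<^sub>m N N @\<^sub>r 1\<^sub>m N"

text \<open>The matrix under the square root is diagonal with nonnegative entries (for \<open>\<rho>x \<ge> 0\<close>), so its
  square root is obtained by applying \<open>sqrt\<close> entrywise.\<close>

definition C_mat :: "real \<Rightarrow> nat \<Rightarrow> real mat" where
  "C_mat \<rho>x N =
     four_block_mat (map_mat sqrt (1\<^sub>m N + \<rho>x \<cdot>\<^sub>m (Omega_mat N ^\<^sub>m 2))) (0\<^sub>m N N)
       (0\<^sub>m 1 N) (0\<^sub>m 1 N)"

definition sym_pos_def :: "nat \<Rightarrow> real mat \<Rightarrow> bool" where
  "sym_pos_def n P \<longleftrightarrow>
     P \<in> carrier_mat n n \<and> P\<^sup>T = P \<and>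
     (\<forall>v \<in> carrier_vec n. v \<noteq> 0\<^sub>v n \<longrightarrow> v \<bullet> (P *\<^sub>v v) > 0)"

definition riccati :: "real mat \<Rightarrow> real mat \<Rightarrow> real mat \<Rightarrow> real mat \<Rightarrow> real \<Rightarrow> real \<Rightarrow> real mat \<Rightarrow> real mat" where
  "riccati A B C E R \<gamma> P =
     P * A + A\<^sup>T * P
     - P * (inverse R \<cdot>\<^sub>m (B * B\<^sup>T) - inverse (\<gamma>\<^sup>2) \<cdot>\<^sub>m (E * E\<^sup>T)) * P
     + C\<^sup>T * C"

definition achievable ::
  "real \<Rightarrow> real \<Rightarrow> real \<Rightarrow> real \<Rightarrow> real \<Rightarrow> real \<Rightarrow> real \<Rightarrow> nat \<Rightarrow> bool" where
  "achievable c1 c2 xL xR \<rho>x \<rho>u \<gamma> N \<longleftrightarrow>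
     (\<forall>n \<in> {N + 1..Mnum c1 c2 N}. rho_denom c1 c2 \<rho>x \<gamma> n > 0) \<and>
     CM_denom \<rho>x \<gamma> (Mnum c1 c2 N) > 0 \<and>
     (\<exists>P. sym_pos_def (2 * N) P \<and>
        riccati (A_mat c1 c2 N) (B_mat xL xR N) (C_mat \<rho>x N) (E_mat N)
          (\<rho>u + rho_inf c1 c2 xL xR \<rho>x \<gamma> N) \<gamma> P
        = 0\<^sub>m (2 * N) (2 * N))"

end

theory Submission
  imports Defs "Jordan_Normal_Form.Determinant" "HOL-Analysis.Function_Topology"
begin

text \<open>
  A positive definite solution \<open>P\<close> of the Riccati equation is a storage function: with the
  gradient \<open>2 P v\<close> of \<open>v \<bullet> P v\<close>, it certifies that a suitable feedback keeps
  \<open>|C v|\<^sup>2 + R u\<^sup>2 - \<gamma>\<^sup>2 |w|\<^sup>2\<close> dissipated for every disturbance \<open>w\<close>.  The theorem then rests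
  on three facts.

  First, a single mode has a storage function of its own, with \<open>\<rho> n\<close> as the price of the control:
  \<open>\<rho> n\<close> is the weight of \<open>u\<^sup>2\<close> that the bounded real lemma gives for one damped oscillator
  (\<open>single_mode_storage\<close>, explicit 2 by 2 matrix).  Adding this storage function to \<open>P\<close> and keeping
  the feedback of the first \<open>N\<close> modes, the \<open>N + 1\<close> modes together dissipate with control
  weight \<open>R - \<rho> (N + 1)\<close>.

  Second, the new control weight \<open>R'\<close> is positive and at most \<open>R - \<rho> (N + 1)\<close>
  (\<open>rho_inf_pos\<close>, \<open>rho_inf_step\<close>).  If \<open>N < M N\<close>, this is an equality, because \<open>\<rho> (N + 1)\<close> is just a
  term of the sum.  If \<open>M N = N\<close>, the mode \<open>N + 1\<close> is so strongly damped that \<open>\<rho> (N + 1)\<close> equals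
  \<open>C\<^sub>N b\<^sup>2 / \<omega>\<^sup>2\<close>, and \<open>C\<^sub>M\<close> decreases with \<open>M\<close>.  The bracket multiplied by \<open>C\<^sub>M\<close> is positive: the
  \<open>b n / \<omega> n\<close> are, up to sign, the Fourier sine coefficients of the indicator function of
  \<open>[xL, xR]\<close>, and Bessel's inequality is strict because infinitely many of them are nonzero.

  These two facts only give a Riccati inequality for \<open>N + 1\<close> modes, since the old feedback
  need not be optimal for them.  The third fact turns it into an equation although the quadratic
  term is indefinite (\<open>riccati_inequality_imp_equation\<close>): among all \<open>P\<close> with \<open>0 \<le> P \<le> X\<close>, where \<open>X\<close> is
  the given solution of the inequality, that satisfy the inequality, one has minimal trace.
  Observability makes it positive definite.  If it did not solve the equation, an explicit
  small step, an implicit Euler step of the Riccati differential equation up to a higher-order term,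
  would decrease it within the same set (\<open>riccati_inequality_descent\<close>).
\<close>

section \<open>Positive semidefinite real matrices\<close>

definition psd :: "nat \<Rightarrow> real mat \<Rightarrow> bool" where
  "psd n M \<longleftrightarrow> M \<in> carrier_mat n n \<and> M\<^sup>T = M \<and> (\<forall>v \<in> carrier_vec n. 0 \<le> v \<bullet> (M *\<^sub>v v))"

lemma scalar_prod_sym_mat:
  assumes "M \<in> carrier_mat n n" "M\<^sup>T = M" "x \<in> carrier_vec n" "y \<in> carrier_vec n"
  shows "x \<bullet> (M *\<^sub>v y) = y \<bullet> (M *\<^sub>v (x :: real vec))"
proof -
  have "x \<bullet> (M *\<^sub>v y) = (M\<^sup>T *\<^sub>v x) \<bullet> y"
    using transpose_vec_mult_scalar[OF assms(1,4,3)] by simp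
  also have "\<dots> = y \<bullet> (M *\<^sub>v x)"
    using assms by (simp add: comm_scalar_prod[of _ n])
  finally show ?thesis .
qed

lemma scalar_prod_self_nonneg: "0 \<le> v \<bullet> (v :: real vec)"
  unfolding scalar_prod_def by (rule sum_nonneg) auto

lemma scalar_prod_self_eq_0:
  assumes "(v :: real vec) \<in> carrier_vec n" "v \<bullet> v = 0"
  shows "v = 0\<^sub>v n"
proof (rule eq_vecI)
  fix i assume "i < dim_vec (0\<^sub>v n :: real vec)"
  hence i: "i < n" by simp
  have "\<forall>i\<in>{0..<dim_vec v}. v $ i * v $ i = 0"
    using assms(2) unfolding scalar_prod_def by (subst (asm) sum_nonneg_eq_0_iff) auto
  thus "v $ i = 0\<^sub>v n $ i" using i assms(1) by auto
qed (use assms in auto)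

lemma quadform_add:
  assumes "M \<in> carrier_mat n n" "M\<^sup>T = M" "x \<in> carrier_vec n" "y \<in> carrier_vec n"
  shows "(x + t \<cdot>\<^sub>v y) \<bullet> (M *\<^sub>v (x + t \<cdot>\<^sub>v y))
    = x \<bullet> (M *\<^sub>v x) + 2 * t * (y \<bullet> (M *\<^sub>v x)) + t\<^sup>2 * (y \<bullet> (M *\<^sub>v (y :: real vec)))"
proof -
  have "M *\<^sub>v (x + t \<cdot>\<^sub>v y) = M *\<^sub>v x + t \<cdot>\<^sub>v (M *\<^sub>v y)"
    using assms by (simp add: mult_add_distrib_mat_vec[of _ n n] mult_mat_vec[of _ n n])
  thus ?thesis using assms scalar_prod_sym_mat[OF assms]
    by (simp add: add_scalar_prod_distrib[of _ n] scalar_prod_add_distrib[of _ n]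
        algebra_simps power2_eq_square)
qed

text \<open>A zero of a nonnegative quadratic form is a minimum, so the derivative \<open>2 M v\<close> vanishes there.\<close>

lemma psd_zero_imp_kernel:
  assumes "psd n M" and v: "v \<in> carrier_vec n" and z: "v \<bullet> (M *\<^sub>v v) = 0"
  shows "M *\<^sub>v v = 0\<^sub>v n"
proof -
  from assms have M: "M \<in> carrier_mat n n" "M\<^sup>T = M"
    and pos: "\<And>v. v \<in> carrier_vec n \<Longrightarrow> 0 \<le> v \<bullet> (M *\<^sub>v v)" by (auto simp: psd_def)
  define w where "w = M *\<^sub>v v"
  have w: "w \<in> carrier_vec n" unfolding w_def using M v by simp
  define a where "a = w \<bullet> w"
  define b where "b = w \<bullet> (M *\<^sub>v w)"
  have a0: "0 \<le> a" unfolding a_def by (rule scalar_prod_self_nonneg)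
  have b0: "0 \<le> b" unfolding b_def using pos w by auto
  have ineq: "0 \<le> 2 * t * a + t\<^sup>2 * b" for t
  proof -
    have c: "v + t \<cdot>\<^sub>v w \<in> carrier_vec n" using v w by simp
    have "M *\<^sub>v v = w" by (simp add: w_def)
    with pos[OF c] show ?thesis unfolding quadform_add[OF M v w] z a_def b_def by simp
  qed
  have "a = 0"
  proof (rule ccontr)
    assume "a \<noteq> 0"
    hence "a > 0" using a0 by simp
    \<comment> \<open>a small negative \<open>t\<close> makes the linear term dominate; \<open>b + 1\<close> avoids a division by zero\<close>
    have "0 \<le> 2 * (- (a / (b + 1))) * a + (- (a / (b + 1)))\<^sup>2 * b" by (rule ineq)
    also have "\<dots> = a\<^sup>2 * (b / (b+1) - 2) / (b+1)"
      using b0 by (simp add: divide_simps power2_eq_square) (simp add: algebra_simps)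
    finally have "0 \<le> a\<^sup>2 * (b / (b+1) - 2) / (b+1)" .
    moreover have "b / (b+1) - 2 < 0" using b0 by (simp add: divide_simps)
    moreover have "a\<^sup>2 > 0" using \<open>a > 0\<close> by simp
    ultimately show False using b0
      by (smt (verit) divide_neg_pos mult_pos_neg)
  qed
  thus ?thesis using scalar_prod_self_eq_0[OF w] by (simp add: a_def w_def)
qed

lemma quadform_bounded:
  assumes "M \<in> carrier_mat n n"
  obtains K where "K > 0" "\<And>v. v \<in> carrier_vec n \<Longrightarrow> \<bar>v \<bullet> (M *\<^sub>v v)\<bar> \<le> K * (v \<bullet> (v :: real vec))"
proof
  define K where "K = 1 + (\<Sum>i<n. \<Sum>j<n. \<bar>M $$ (i,j)\<bar>)"
  show "K > 0" unfolding K_def by (smt (verit) sum_nonneg abs_ge_zero)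
  fix v :: "real vec" assume v: "v \<in> carrier_vec n"
  have le: "(v $ i)\<^sup>2 \<le> v \<bullet> v" if "i < n" for i
  proof -
    have "(v $ i)\<^sup>2 = v $ i * v $ i" by (simp add: power2_eq_square)
    also have "\<dots> \<le> v \<bullet> v" unfolding scalar_prod_def
      by (rule member_le_sum[where f = "\<lambda>i. v $ i * v $ i"]) (use that v in auto)
    finally show ?thesis .
  qed
  have "v \<bullet> (M *\<^sub>v v) = (\<Sum>i<n. \<Sum>j<n. v $ i * (M $$ (i,j) * v $ j))"
    using v assms by (simp add: scalar_prod_def sum_distrib_left lessThan_atLeast0)
  also have "\<bar>\<dots>\<bar> \<le> (\<Sum>i<n. \<Sum>j<n. \<bar>M $$ (i,j)\<bar> * (v \<bullet> v))"
  proof (rule order_trans[OF sum_abs], rule sum_mono, rule order_trans[OF sum_abs], rule sum_mono)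
    fix i j assume "i \<in> {..<n}" "j \<in> {..<n}"
    hence "(v $ i)\<^sup>2 \<le> v \<bullet> v" "(v $ j)\<^sup>2 \<le> v \<bullet> v" using le by auto
    moreover have "2 * \<bar>v $ i * v $ j\<bar> \<le> (v $ i)\<^sup>2 + (v $ j)\<^sup>2"
      using sum_squares_bound[of "\<bar>v $ i\<bar>" "\<bar>v $ j\<bar>"] by (simp add: abs_mult)
    ultimately have "\<bar>v $ i * v $ j\<bar> \<le> v \<bullet> v" by linarith
    hence "\<bar>M $$ (i,j)\<bar> * \<bar>v $ i * v $ j\<bar> \<le> \<bar>M $$ (i,j)\<bar> * (v \<bullet> v)"
      by (rule mult_left_mono) simp
    thus "\<bar>v $ i * (M $$ (i,j) * v $ j)\<bar> \<le> \<bar>M $$ (i,j)\<bar> * (v \<bullet> v)"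
      by (simp add: abs_mult mult_ac)
  qed
  also have "\<dots> = (K - 1) * (v \<bullet> v)" by (simp add: K_def sum_distrib_right)
  also have "\<dots> \<le> K * (v \<bullet> v)" using scalar_prod_self_nonneg[of v] by (simp add: algebra_simps)
  finally show "\<bar>v \<bullet> (M *\<^sub>v v)\<bar> \<le> K * (v \<bullet> v)" .
qed

text \<open>If \<open>0 \<le> M \<le> l\<close>, then \<open>M\<^sup>2 \<le> l M\<close>: evaluate the form at \<open>v - M v / l\<close>.\<close>

lemma psd_image_norm_le:
  assumes "psd n M" and v: "v \<in> carrier_vec n" and "l > 0"
    and le: "\<And>v. v \<in> carrier_vec n \<Longrightarrow> v \<bullet> (M *\<^sub>v v) \<le> l * (v \<bullet> v)"
  shows "(M *\<^sub>v v) \<bullet> (M *\<^sub>v v) \<le> l * (v \<bullet> (M *\<^sub>v v))"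
proof -
  from assms have M: "M \<in> carrier_mat n n" "M\<^sup>T = M"
    and pos: "\<And>v. v \<in> carrier_vec n \<Longrightarrow> 0 \<le> v \<bullet> (M *\<^sub>v v)" by (auto simp: psd_def)
  define w where "w = M *\<^sub>v v"
  have w: "w \<in> carrier_vec n" unfolding w_def using M v by simp
  define t where "t = - (1 / l)"
  have c: "v + t \<cdot>\<^sub>v w \<in> carrier_vec n" using v w by simp
  have Mv: "M *\<^sub>v v = w" by (simp add: w_def)
  have "0 \<le> v \<bullet> w + 2 * t * (w \<bullet> w) + t\<^sup>2 * (w \<bullet> (M *\<^sub>v w))"
    using pos[OF c] unfolding quadform_add[OF M v w] Mv .
  also have "\<dots> \<le> v \<bullet> w + 2 * t * (w \<bullet> w) + t\<^sup>2 * (l * (w \<bullet> w))"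
    using le[OF w] by (intro add_left_mono mult_left_mono) auto
  also have "\<dots> = v \<bullet> w - (w \<bullet> w) / l"
    using \<open>l > 0\<close> by (simp add: t_def power2_eq_square field_simps)
  finally show ?thesis using \<open>l > 0\<close> by (simp add: w_def field_simps)
qed

lemma right_inverse_if_kernel_trivial:
  assumes M: "M \<in> carrier_mat n n"
    and ker: "\<And>v. v \<in> carrier_vec n \<Longrightarrow> M *\<^sub>v v = 0\<^sub>v n \<Longrightarrow> v = 0\<^sub>v n"
  obtains U where "U \<in> carrier_mat n n" "M * U = 1\<^sub>m n" "U * M = (1\<^sub>m n :: real mat)"
proof -
  have "det M \<noteq> 0" using det_0_iff_vec_prod_zero[OF M] ker by blast
  from det_non_zero_imp_unit[OF M this, of "()"] show ?thesis
    using that unfolding Units_def ring_mat_def by auto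
qed

text \<open>The constant is the reciprocal of a bound \<open>K\<close> for \<open>P\<^sup>-\<^sup>1\<close>, read off from the form at
\<open>v - P\<^sup>-\<^sup>1 v / K\<close>; this replaces a compactness argument on the unit sphere.\<close>

lemma posdef_coercive:
  assumes "sym_pos_def n P"
  obtains e where "e > 0" "\<And>v. v \<in> carrier_vec n \<Longrightarrow> e * (v \<bullet> v) \<le> v \<bullet> (P *\<^sub>v v)"
proof -
  from assms have P: "P \<in> carrier_mat n n" "P\<^sup>T = P"
    and pos: "\<And>v. v \<in> carrier_vec n \<Longrightarrow> v \<noteq> 0\<^sub>v n \<Longrightarrow> 0 < v \<bullet> (P *\<^sub>v v)"
    by (auto simp: sym_pos_def_def)
  have pos0: "0 \<le> v \<bullet> (P *\<^sub>v v)" if "v \<in> carrier_vec n" for v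
    using pos[OF that] P by (cases "v = 0\<^sub>v n") (auto simp: less_imp_le)
  obtain U where U: "U \<in> carrier_mat n n" "P * U = 1\<^sub>m n"
  proof (rule right_inverse_if_kernel_trivial[OF P(1)])
    fix v assume v: "v \<in> carrier_vec n" "P *\<^sub>v v = 0\<^sub>v n"
    show "v = 0\<^sub>v n" using pos[OF v(1)] v by auto
  qed blast
  obtain K where K: "K > 0" "\<And>v. v \<in> carrier_vec n \<Longrightarrow> \<bar>v \<bullet> (U *\<^sub>v v)\<bar> \<le> K * (v \<bullet> v)"
    using quadform_bounded[OF U(1)] by blast
  show ?thesis
  proof (rule that[of "1 / K"])
    fix v :: "real vec" assume v: "v \<in> carrier_vec n"
    define w where "w = U *\<^sub>v v"
    have w: "w \<in> carrier_vec n" using U v by (simp add: w_def)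
    have Pw: "P *\<^sub>v w = v" unfolding w_def
      using assoc_mult_mat_vec[OF P(1) U(1) v] U(2) v by simp
    define t where "t = - (1 / K)"
    have c: "v + t \<cdot>\<^sub>v w \<in> carrier_vec n" using v w by simp
    have wv: "w \<bullet> v \<le> K * (v \<bullet> v)"
      using K(2)[OF v] comm_scalar_prod[OF v w] by (simp add: w_def)
    have "w \<bullet> (P *\<^sub>v v) = v \<bullet> v" using scalar_prod_sym_mat[OF P w v] Pw by simp
    hence "0 \<le> v \<bullet> (P *\<^sub>v v) + 2 * t * (v \<bullet> v) + t\<^sup>2 * (w \<bullet> v)"
      using pos0[OF c] unfolding quadform_add[OF P v w] Pw by simp
    also have "\<dots> \<le> v \<bullet> (P *\<^sub>v v) + 2 * t * (v \<bullet> v) + t\<^sup>2 * (K * (v \<bullet> v))"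
      using wv by (intro add_left_mono mult_left_mono) auto
    also have "\<dots> = v \<bullet> (P *\<^sub>v v) - 1 / K * (v \<bullet> v)"
      using K(1) by (simp add: t_def power2_eq_square field_simps)
    finally show "1 / K * (v \<bullet> v) \<le> v \<bullet> (P *\<^sub>v v)" by simp
  qed (use K in auto)
qed

lemma mat_eq_0_if_mult_vec_eq_0:
  assumes M: "M \<in> carrier_mat m n" and "\<And>v. v \<in> carrier_vec n \<Longrightarrow> M *\<^sub>v v = 0\<^sub>v m"
  shows "M = (0\<^sub>m m n :: real mat)"
proof (rule eq_matI)
  fix i j assume "i < dim_row (0\<^sub>m m n :: real mat)" "j < dim_col (0\<^sub>m m n :: real mat)"
  hence ij: "i < m" "j < n" by auto
  have "(M *\<^sub>v unit_vec n j) $ i = M $$ (i, j)" using M ij by simp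
  moreover have "(M *\<^sub>v unit_vec n j) $ i = 0" using assms(2)[of "unit_vec n j"] ij by simp
  ultimately show "M $$ (i, j) = 0\<^sub>m m n $$ (i, j)" using ij by simp
qed (use M in auto)

lemma smult_mat_mult_vec:
  assumes "M \<in> carrier_mat m n" "v \<in> carrier_vec n"
  shows "(k \<cdot>\<^sub>m M) *\<^sub>v v = (k :: real) \<cdot>\<^sub>v (M *\<^sub>v v)"
  by (rule eq_vecI) (use assms in \<open>simp_all add: scalar_prod_def sum_distrib_left mult.assoc\<close>)

lemma uminus_zero_mat: "- 0\<^sub>m m n = (0\<^sub>m m n :: real mat)"
  by (rule eq_matI) auto

text \<open>The entry is a coordinate of the image of a unit vector, whose norm is at most \<open>l\<close>.\<close>

lemma psd_entry_le:
  assumes M: "psd n M" and l: "l > 0" and le: "\<And>v. v \<in> carrier_vec n \<Longrightarrow> v \<bullet> (M *\<^sub>v v) \<le> l * (v \<bullet> v)"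
    and ij: "i < n" "j < n"
  shows "\<bar>M $$ (i, j)\<bar> \<le> l"
proof -
  have Mc: "M \<in> carrier_mat n n" using M by (simp add: psd_def)
  define u :: "real vec" where "u = unit_vec n j"
  have u: "u \<in> carrier_vec n" "u \<bullet> u = 1" using ij by (auto simp: u_def)
  have Mu: "M *\<^sub>v u \<in> carrier_vec n" using Mc u by simp
  have "(M *\<^sub>v u) $ i = M $$ (i, j)" using Mc ij by (simp add: u_def)
  hence "(M $$ (i, j))\<^sup>2 = (M *\<^sub>v u) $ i * (M *\<^sub>v u) $ i" by (simp add: power2_eq_square)
  also have "\<dots> \<le> (M *\<^sub>v u) \<bullet> (M *\<^sub>v u)" unfolding scalar_prod_def
    by (rule member_le_sum[where f = "\<lambda>i. (M *\<^sub>v u) $ i * (M *\<^sub>v u) $ i"]) (use Mc ij in auto)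
  also have "\<dots> \<le> l * (u \<bullet> (M *\<^sub>v u))" by (rule psd_image_norm_le[OF M u(1) l le])
  also have "\<dots> \<le> l * (l * (u \<bullet> u))" using le[OF u(1)] l by (intro mult_left_mono) auto
  finally have "(M $$ (i, j))\<^sup>2 \<le> l\<^sup>2" by (simp add: u power2_eq_square)
  thus ?thesis using l by (simp add: abs_le_square_iff[symmetric])
qed

lemma psd_trace_zero_imp_zero:
  assumes M: "psd n M" and tr: "(\<Sum>i<n. M $$ (i, i)) \<le> 0"
  shows "M = 0\<^sub>m n n"
proof -
  have Mc: "M \<in> carrier_mat n n" using M by (simp add: psd_def)
  have diag: "unit_vec n i \<bullet> (M *\<^sub>v unit_vec n i) = M $$ (i, i)" if "i < n" for i
    using that Mc by (simp add: scalar_prod_left_unit[of _ n])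
  have nonneg: "0 \<le> M $$ (i, i)" if "i < n" for i
    using M diag[OF that] unfolding psd_def by (metis unit_vec_carrier)
  have zero: "M $$ (i, i) = 0" if "i < n" for i
  proof -
    have "M $$ (i, i) \<le> (\<Sum>i<n. M $$ (i, i))"
      by (rule member_le_sum) (use that nonneg in auto)
    thus ?thesis using nonneg[OF that] tr by linarith
  qed
  show ?thesis
  proof (rule eq_matI)
    fix i j assume "i < dim_row (0\<^sub>m n n :: real mat)" "j < dim_col (0\<^sub>m n n :: real mat)"
    hence ij: "i < n" "j < n" by auto
    have "M *\<^sub>v unit_vec n j = 0\<^sub>v n"
      by (rule psd_zero_imp_kernel[OF M]) (use diag[OF ij(2)] zero[OF ij(2)] in auto)
    hence "(M *\<^sub>v unit_vec n j) $ i = 0" using ij by simp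
    thus "M $$ (i, j) = 0\<^sub>m n n $$ (i, j)" using Mc ij by simp
  qed (use Mc in auto)
qed

lemma transpose_mult_self_quadform:
  assumes M: "M \<in> carrier_mat m n" and v: "v \<in> carrier_vec n"
  shows "v \<bullet> (M\<^sup>T * M *\<^sub>v v) = (M *\<^sub>v v) \<bullet> (M *\<^sub>v (v :: real vec))"
proof -
  have Mv: "M *\<^sub>v v \<in> carrier_vec m" using M v by simp
  have "v \<bullet> (M\<^sup>T * M *\<^sub>v v) = (M\<^sup>T *\<^sub>v (M *\<^sub>v v)) \<bullet> v"
    using assms Mv by (simp add: assoc_mult_mat_vec[of _ n m _ n] comm_scalar_prod[of v n])
  thus ?thesis using transpose_vec_mult_scalar[OF M v Mv] by simp
qed

lemma psd_transpose_mult_self: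
  assumes M: "M \<in> carrier_mat m n"
  shows "psd n (M\<^sup>T * (M :: real mat))"
  unfolding psd_def using M
  by (auto simp: transpose_mult_self_quadform[OF M] scalar_prod_self_nonneg transpose_mult[of _ n m _ n]
      simp del: assoc_mult_mat_vec)

section \<open>From a Riccati inequality to a Riccati equation\<close>

definition ric :: "real mat \<Rightarrow> real mat \<Rightarrow> real mat \<Rightarrow> real mat \<Rightarrow> real mat" where
  "ric A S Q P = P * A + A\<^sup>T * P + P * S * P + Q"

lemma ric_carrier [simp]:
  assumes "A \<in> carrier_mat n n" "S \<in> carrier_mat n n" "Q \<in> carrier_mat n n" "P \<in> carrier_mat n n"
  shows "ric A S Q P \<in> carrier_mat n n"
  using assms by (auto simp: ric_def)

lemma ric_symmetric:
  assumes A: "A \<in> carrier_mat n n" and S: "S \<in> carrier_mat n n" "S\<^sup>T = S"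
    and Q: "Q \<in> carrier_mat n n" "Q\<^sup>T = Q" and P: "P \<in> carrier_mat n n" "P\<^sup>T = P"
  shows "(ric A S Q P)\<^sup>T = ric A S Q P"
proof -
  have "(ric A S Q P)\<^sup>T = (P * A)\<^sup>T + (A\<^sup>T * P)\<^sup>T + (P * S * P)\<^sup>T + Q\<^sup>T"
    unfolding ric_def using A S(1) Q(1) P(1) by (simp add: transpose_add[of _ n n])
  also have "\<dots> = A\<^sup>T * P + P * A + P * (S * P) + Q"
    using A S Q P by (simp add: transpose_mult[of _ n n _ n])
  also have "\<dots> = ric A S Q P"
    unfolding ric_def using A S(1) Q(1) P(1)
    by (simp add: assoc_mult_mat[of _ n n _ n _ n] comm_add_mat[of "P * A" n n])
  finally show ?thesis .
qed

lemma ric_mult_vec: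
  assumes A: "A \<in> carrier_mat n n" and S: "S \<in> carrier_mat n n"
    and Q: "Q \<in> carrier_mat n n" and P: "P \<in> carrier_mat n n" and v: "v \<in> carrier_vec n"
  shows "ric A S Q P *\<^sub>v v = P *\<^sub>v (A *\<^sub>v v) + A\<^sup>T *\<^sub>v (P *\<^sub>v v) + P *\<^sub>v (S *\<^sub>v (P *\<^sub>v v)) + Q *\<^sub>v v"
  unfolding ric_def using assms
  by (simp add: add_mult_distrib_mat_vec[of _ n n] assoc_mult_mat_vec[of _ n n _ n])

lemma ric_quadform:
  assumes A: "A \<in> carrier_mat n n" and S: "S \<in> carrier_mat n n"
    and Q: "Q \<in> carrier_mat n n" and P: "P \<in> carrier_mat n n" "P\<^sup>T = P" and v: "v \<in> carrier_vec n"
  shows "v \<bullet> (ric A S Q P *\<^sub>v v)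
    = 2 * ((P *\<^sub>v v) \<bullet> (A *\<^sub>v v)) + (P *\<^sub>v v) \<bullet> (S *\<^sub>v (P *\<^sub>v v)) + v \<bullet> (Q *\<^sub>v v)"
proof -
  have Av: "A *\<^sub>v v \<in> carrier_vec n" and Pv: "P *\<^sub>v v \<in> carrier_vec n" using A P v by auto
  have SPv: "S *\<^sub>v (P *\<^sub>v v) \<in> carrier_vec n" using S Pv by auto
  have 1: "v \<bullet> (P *\<^sub>v (A *\<^sub>v v)) = (P *\<^sub>v v) \<bullet> (A *\<^sub>v v)"
    using scalar_prod_sym_mat[OF P v Av] comm_scalar_prod[OF Av Pv] by simp
  have 2: "v \<bullet> (A\<^sup>T *\<^sub>v (P *\<^sub>v v)) = (P *\<^sub>v v) \<bullet> (A *\<^sub>v v)"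
    using transpose_vec_mult_scalar[OF A v Pv] comm_scalar_prod[of "A\<^sup>T *\<^sub>v (P *\<^sub>v v)" n v] A Pv v
    by auto
  have 3: "v \<bullet> (P *\<^sub>v (S *\<^sub>v (P *\<^sub>v v))) = (P *\<^sub>v v) \<bullet> (S *\<^sub>v (P *\<^sub>v v))"
    using scalar_prod_sym_mat[OF P v SPv] comm_scalar_prod[OF SPv Pv] by simp
  have "v \<bullet> (ric A S Q P *\<^sub>v v) = v \<bullet> (P *\<^sub>v (A *\<^sub>v v)) + v \<bullet> (A\<^sup>T *\<^sub>v (P *\<^sub>v v))
      + v \<bullet> (P *\<^sub>v (S *\<^sub>v (P *\<^sub>v v))) + v \<bullet> (Q *\<^sub>v v)"
    unfolding ric_mult_vec[OF A S Q P(1) v] using assms Av Pv SPv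
    by (simp add: scalar_prod_add_distrib[of _ n])
  thus ?thesis unfolding 1 2 3 by simp
qed

text \<open>Write \<open>W = - ric P \<ge> 0\<close> and \<open>F = A + S P\<close>.  Subtracting \<open>D\<close> changes \<open>ric\<close> by
\<open>- (D F + F\<^sup>T D) + D S D\<close>, which must stay below \<open>W\<close>.  The matrix \<open>D = h U\<^sup>T W U\<close> with
\<open>U = (1 - h F)\<^sup>-\<^sup>1\<close> satisfies \<open>(1 - h F)\<^sup>T D (1 - h F) = h W\<close>; expanding this and dropping
\<open>h\<^sup>2 F\<^sup>T D F \<ge> 0\<close> gives \<open>- (D F + F\<^sup>T D) \<le> W - D / h\<close>.  Since \<open>D\<close> is of order \<open>h\<close>, the surplus
\<open>D / h\<close> absorbs the indefinite term \<open>D S D\<close> for small \<open>h\<close>, and \<open>D \<le> P\<close>.\<close>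

lemma riccati_inequality_descent:
  assumes A: "A \<in> carrier_mat n n" and S: "S \<in> carrier_mat n n" "S\<^sup>T = S"
    and Q: "Q \<in> carrier_mat n n" "Q\<^sup>T = Q" and P: "sym_pos_def n P"
    and le: "\<And>v. v \<in> carrier_vec n \<Longrightarrow> v \<bullet> (ric A S Q P *\<^sub>v v) \<le> 0"
    and ne: "ric A S Q P \<noteq> 0\<^sub>m n n"
  obtains D where "psd n D" "D \<noteq> 0\<^sub>m n n" "psd n (P - D)"
    "\<And>v. v \<in> carrier_vec n \<Longrightarrow> v \<bullet> (ric A S Q (P - D) *\<^sub>v v) \<le> 0"
proof -
  have Pc: "P \<in> carrier_mat n n" "P\<^sup>T = P" using P by (auto simp: sym_pos_def_def)
  define W where "W = - ric A S Q P"
  have Wc: "W \<in> carrier_mat n n" using A S Q Pc by (simp add: W_def)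
  have Wv: "v \<bullet> (W *\<^sub>v v) = - (v \<bullet> (ric A S Q P *\<^sub>v v))" if "v \<in> carrier_vec n" for v
  proof -
    have "dim_vec v = n" "dim_row (ric A S Q P) = n" "dim_col (ric A S Q P) = n"
      using that ric_carrier[OF A S(1) Q(1) Pc(1)] by auto
    thus ?thesis unfolding W_def by simp
  qed
  have Wsym: "W\<^sup>T = W" unfolding W_def transpose_uminus ric_symmetric[OF A S Q Pc] ..
  have Wpsd: "psd n W" unfolding psd_def using Wc Wsym Wv le by auto
  define F where "F = A + S * P"
  have F: "F \<in> carrier_mat n n" using A S Pc by (simp add: F_def)
  obtain KF where KF: "KF > 0" "\<And>v. v \<in> carrier_vec n \<Longrightarrow> \<bar>v \<bullet> (F *\<^sub>v v)\<bar> \<le> KF * (v \<bullet> v)"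
    using quadform_bounded[OF F] by blast
  obtain KW where KW: "KW > 0" "\<And>v. v \<in> carrier_vec n \<Longrightarrow> \<bar>v \<bullet> (W *\<^sub>v v)\<bar> \<le> KW * (v \<bullet> v)"
    using quadform_bounded[OF Wc] by blast
  obtain KS where KS: "KS > 0" "\<And>v. v \<in> carrier_vec n \<Longrightarrow> \<bar>v \<bullet> (S *\<^sub>v v)\<bar> \<le> KS * (v \<bullet> v)"
    using quadform_bounded[OF S(1)] by blast
  obtain e where e: "e > 0" "\<And>v. v \<in> carrier_vec n \<Longrightarrow> e * (v \<bullet> v) \<le> v \<bullet> (P *\<^sub>v v)"
    using posdef_coercive[OF P] by blast
  \<comment> \<open>the four bounds ensure \<open>h\<^sup>2 \<le> h\<close>, invertibility of \<open>1 - h F\<close>, \<open>D \<le> P\<close>, and \<open>D S D \<le> D / h\<close>\<close>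
  define h where "h = Min {1, 1 / (4 * KF), e / (2 * KW), 1 / (2 * KS * KW)}"
  have h0: "h > 0" unfolding h_def using KF KW KS e by simp
  have hle: "h \<le> 1" "h \<le> 1 / (4 * KF)" "h \<le> e / (2 * KW)" "h \<le> 1 / (2 * KS * KW)"
    unfolding h_def by (auto intro: Min_le)
  have h1: "2 * h * KF \<le> 1/2" using hle(2) KF(1) by (simp add: field_simps)
  have h2: "2 * h * KW \<le> e" using hle(3) KW(1) by (simp add: field_simps)
  have h3: "KS * (2 * h * KW) \<le> 1 / h"
  proof -
    have "KS * (2 * h * KW) \<le> 1" using hle(4) KS(1) KW(1) by (simp add: field_simps)
    also have "1 \<le> 1 / h" using h0 hle(1) by simp
    finally show ?thesis .
  qed
  define T where "T = 1\<^sub>m n + (-h) \<cdot>\<^sub>m F"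
  have T: "T \<in> carrier_mat n n" using F by (simp add: T_def)
  have Tv: "T *\<^sub>v v = v + (-h) \<cdot>\<^sub>v (F *\<^sub>v v)" if "v \<in> carrier_vec n" for v
    unfolding T_def using that F
    by (simp add: add_mult_distrib_mat_vec[of _ n n] smult_mat_mult_vec[of _ n n])
  have Tnorm: "v \<bullet> v \<le> 2 * ((T *\<^sub>v v) \<bullet> (T *\<^sub>v v))" if v: "v \<in> carrier_vec n" for v
  proof -
    have Fv: "F *\<^sub>v v \<in> carrier_vec n" using F v by simp
    have "(T *\<^sub>v v) \<bullet> (T *\<^sub>v v) = v \<bullet> v + 2 * (-h) * ((F *\<^sub>v v) \<bullet> v) + (-h)\<^sup>2 * ((F *\<^sub>v v) \<bullet> (F *\<^sub>v v))"
      using quadform_add[of "1\<^sub>m n" n v "F *\<^sub>v v" "-h"] v Fv Tv[OF v] by simp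
    moreover have "(F *\<^sub>v v) \<bullet> v \<le> KF * (v \<bullet> v)"
      using KF(2)[OF v] comm_scalar_prod[OF v Fv] by simp
    hence "2 * h * ((F *\<^sub>v v) \<bullet> v) \<le> 2 * h * (KF * (v \<bullet> v))"
      using h0 by (intro mult_left_mono) auto
    moreover have "2 * h * (KF * (v \<bullet> v)) \<le> 1/2 * (v \<bullet> v)"
      using mult_right_mono[OF h1 scalar_prod_self_nonneg[of v]] by (simp add: mult_ac)
    moreover have "0 \<le> (-h)\<^sup>2 * ((F *\<^sub>v v) \<bullet> (F *\<^sub>v v))"
      using scalar_prod_self_nonneg[of "F *\<^sub>v v"] by simp
    ultimately show ?thesis by simp
  qed
  obtain U where U: "U \<in> carrier_mat n n" "T * U = 1\<^sub>m n" "U * T = 1\<^sub>m n"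
  proof (rule right_inverse_if_kernel_trivial[OF T])
    fix v assume v: "v \<in> carrier_vec n" "T *\<^sub>v v = 0\<^sub>v n"
    have "v \<bullet> v = 0" using Tnorm[OF v(1)] v(2) scalar_prod_self_nonneg[of v] by simp
    thus "v = 0\<^sub>v n" using scalar_prod_self_eq_0 v(1) by blast
  qed blast
  define D where "D = h \<cdot>\<^sub>m (U\<^sup>T * (W * U))"
  have Dc: "D \<in> carrier_mat n n" using U Wc by (simp add: D_def)
  have Dsym: "D\<^sup>T = D"
  proof -
    have "(U\<^sup>T * (W * U))\<^sup>T = (W * U)\<^sup>T * U"
      using U(1) Wc by (simp add: transpose_mult[of _ n n _ n])
    also have "\<dots> = U\<^sup>T * W * U"
      using U(1) Wc Wsym by (simp add: transpose_mult[of _ n n _ n])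
    also have "\<dots> = U\<^sup>T * (W * U)" using U(1) Wc by (simp add: assoc_mult_mat[of _ n n _ n _ n])
    finally have "(U\<^sup>T * (W * U))\<^sup>T = U\<^sup>T * (W * U)" .
    moreover have "(h \<cdot>\<^sub>m M)\<^sup>T = h \<cdot>\<^sub>m M\<^sup>T" for M :: "real mat" by (rule eq_matI) auto
    ultimately show ?thesis by (simp add: D_def)
  qed
  have Dv: "v \<bullet> (D *\<^sub>v v) = h * ((U *\<^sub>v v) \<bullet> (W *\<^sub>v (U *\<^sub>v v)))" if v: "v \<in> carrier_vec n" for v
  proof -
    have Uv: "U *\<^sub>v v \<in> carrier_vec n" using U v by simp
    have WUv: "W *\<^sub>v (U *\<^sub>v v) \<in> carrier_vec n" using Wc Uv by simp
    have "D *\<^sub>v v = h \<cdot>\<^sub>v (U\<^sup>T *\<^sub>v (W *\<^sub>v (U *\<^sub>v v)))"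
      unfolding D_def using U Wc v by (simp add: smult_mat_mult_vec[of _ n n] assoc_mult_mat_vec[of _ n n _ n])
    moreover have "v \<bullet> (U\<^sup>T *\<^sub>v (W *\<^sub>v (U *\<^sub>v v))) = (U *\<^sub>v v) \<bullet> (W *\<^sub>v (U *\<^sub>v v))"
      using transpose_vec_mult_scalar[OF U(1) v WUv] comm_scalar_prod[of "U\<^sup>T *\<^sub>v (W *\<^sub>v (U *\<^sub>v v))" n v]
        comm_scalar_prod[OF WUv Uv] U(1) WUv v by auto
    ultimately show ?thesis using U(1) v WUv by simp
  qed
  have UT: "U *\<^sub>v (T *\<^sub>v v) = v" if "v \<in> carrier_vec n" for v
    using assoc_mult_mat_vec[OF U(1) T that] U(3) that by simp
  have TU: "T *\<^sub>v (U *\<^sub>v v) = v" if "v \<in> carrier_vec n" for v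
    using assoc_mult_mat_vec[OF T U(1) that] U(2) that by simp
  have Dpsd: "psd n D"
    unfolding psd_def
  proof (intro conjI ballI Dc Dsym)
    fix v :: "real vec" assume v: "v \<in> carrier_vec n"
    have "U *\<^sub>v v \<in> carrier_vec n" using U v by simp
    thus "0 \<le> v \<bullet> (D *\<^sub>v v)" unfolding Dv[OF v] using Wpsd h0 by (simp add: psd_def)
  qed
  have Dle: "v \<bullet> (D *\<^sub>v v) \<le> 2 * h * KW * (v \<bullet> v)" if v: "v \<in> carrier_vec n" for v
  proof -
    have Uv: "U *\<^sub>v v \<in> carrier_vec n" using U v by simp
    have "(U *\<^sub>v v) \<bullet> (W *\<^sub>v (U *\<^sub>v v)) \<le> KW * ((U *\<^sub>v v) \<bullet> (U *\<^sub>v v))"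
      using KW(2)[OF Uv] by simp
    also have "\<dots> \<le> KW * (2 * (v \<bullet> v))"
      using Tnorm[OF Uv] TU[OF v] KW(1) by simp
    finally show ?thesis unfolding Dv[OF v] using h0 by (simp add: mult_ac)
  qed
  define c where "c = 2 * h * KW"
  have c0: "c > 0" using h0 KW by (simp add: c_def)
  have PD: "(P - D) *\<^sub>v v = P *\<^sub>v v - D *\<^sub>v v" if v: "v \<in> carrier_vec n" for v
    using minus_mult_distrib_mat_vec[OF Pc(1) Dc v] .
  have PDc: "P - D \<in> carrier_mat n n" "(P - D)\<^sup>T = P - D"
    using Pc Dc Dsym by (auto simp: transpose_minus[of _ n n])
  show ?thesis
  proof (rule that[OF Dpsd])
    show "D \<noteq> 0\<^sub>m n n"
    proof
      assume D0: "D = 0\<^sub>m n n"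
      have "W *\<^sub>v v = 0\<^sub>v n" if v: "v \<in> carrier_vec n" for v
      proof -
        have Tv: "T *\<^sub>v v \<in> carrier_vec n" using T v by simp
        have "0\<^sub>m n n *\<^sub>v (T *\<^sub>v v) = 0\<^sub>v n" using Tv by (intro eq_vecI) auto
        hence "v \<bullet> (W *\<^sub>v v) = 0" using Dv[OF Tv] UT[OF v] h0 D0 Tv by simp
        thus ?thesis using psd_zero_imp_kernel[OF Wpsd v] by simp
      qed
      hence "W = 0\<^sub>m n n" by (rule mat_eq_0_if_mult_vec_eq_0[OF Wc])
      hence "ric A S Q P = 0\<^sub>m n n"
        unfolding W_def by (metis uminus_uminus_mat uminus_zero_mat)
      thus False using ne by simp
    qed
    show "psd n (P - D)"
      unfolding psd_def
    proof (intro conjI ballI PDc)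
      fix v :: "real vec" assume v: "v \<in> carrier_vec n"
      have "v \<bullet> ((P - D) *\<^sub>v v) = v \<bullet> (P *\<^sub>v v) - v \<bullet> (D *\<^sub>v v)"
        unfolding PD[OF v] using Pc Dc v by (simp add: scalar_prod_minus_distrib[of _ n])
      moreover have "2 * h * KW * (v \<bullet> v) \<le> e * (v \<bullet> v)"
        using h2 scalar_prod_self_nonneg[of v] by (rule mult_right_mono)
      ultimately show "0 \<le> v \<bullet> ((P - D) *\<^sub>v v)" using e(2)[OF v] Dle[OF v] by linarith
    qed
    fix v :: "real vec" assume v: "v \<in> carrier_vec n"
    define x where "x = P *\<^sub>v v"
    define d where "d = D *\<^sub>v v"
    define f where "f = F *\<^sub>v v"
    define a where "a = A *\<^sub>v v"
    have cs: "x \<in> carrier_vec n" "d \<in> carrier_vec n" "f \<in> carrier_vec n" "a \<in> carrier_vec n"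
      "S *\<^sub>v x \<in> carrier_vec n"
      using Pc Dc F A S v by (auto simp: x_def d_def f_def a_def)
    have f: "f = a + S *\<^sub>v x"
      unfolding f_def F_def a_def x_def using A S Pc v
      by (simp add: add_mult_distrib_mat_vec[of _ n n] assoc_mult_mat_vec[of _ n n _ n])
    have expand: "v \<bullet> (ric A S Q (P - D) *\<^sub>v v)
      = v \<bullet> (ric A S Q P *\<^sub>v v) - 2 * (d \<bullet> f) + d \<bullet> (S *\<^sub>v d)"
    proof -
      have "(x - d) \<bullet> (S *\<^sub>v (x - d)) = x \<bullet> (S *\<^sub>v x) - 2 * (d \<bullet> (S *\<^sub>v x)) + d \<bullet> (S *\<^sub>v d)"
      proof -
        have "x - d = x + (-1) \<cdot>\<^sub>v d" using cs by auto
        thus ?thesis using quadform_add[OF S cs(1,2), of "-1"] by simp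
      qed
      moreover have "d \<bullet> f = d \<bullet> a + d \<bullet> (S *\<^sub>v x)" unfolding f using cs
        by (simp add: scalar_prod_add_distrib[of _ n])
      moreover have "(x - d) \<bullet> a = x \<bullet> a - d \<bullet> a" using cs by (simp add: minus_scalar_prod_distrib[of _ n])
      ultimately show ?thesis
        unfolding ric_quadform[OF A S(1) Q(1) PDc v] ric_quadform[OF A S(1) Q(1) Pc v] PD[OF v]
          x_def[symmetric] d_def[symmetric] a_def[symmetric] by simp
    qed
    have Tvc: "T *\<^sub>v v \<in> carrier_vec n" using T v by simp
    have "h * (v \<bullet> (W *\<^sub>v v)) = (v + (-h) \<cdot>\<^sub>v f) \<bullet> (D *\<^sub>v (v + (-h) \<cdot>\<^sub>v f))"
      using Dv[OF Tvc] UT[OF v] Tv[OF v] by (simp add: f_def)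
    also have "\<dots> = v \<bullet> d - 2 * h * (d \<bullet> f) + h\<^sup>2 * (f \<bullet> (D *\<^sub>v f))"
      using quadform_add[OF Dc Dsym v cs(3), of "-h"] comm_scalar_prod[OF cs(2,3)]
      by (simp add: d_def)
    also have "\<dots> \<ge> v \<bullet> d - 2 * h * (d \<bullet> f)" using Dpsd cs(3) by (simp add: psd_def)
    finally have "h * (v \<bullet> (W *\<^sub>v v)) \<ge> v \<bullet> d - 2 * h * (d \<bullet> f)" .
    hence "v \<bullet> (W *\<^sub>v v) \<ge> (v \<bullet> d) / h - 2 * (d \<bullet> f)"
      using h0 by (simp add: field_simps)
    hence 1: "v \<bullet> (ric A S Q P *\<^sub>v v) - 2 * (d \<bullet> f) \<le> - ((v \<bullet> d) / h)"
      using Wv[OF v] by simp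
    have vd0: "0 \<le> v \<bullet> d" using Dpsd v by (simp add: psd_def d_def)
    have "d \<bullet> (S *\<^sub>v d) \<le> KS * (d \<bullet> d)" using KS(2)[OF cs(2)] by simp
    also have "d \<bullet> d \<le> c * (v \<bullet> d)"
      unfolding d_def by (rule psd_image_norm_le[OF Dpsd v c0]) (use Dle in \<open>auto simp: c_def\<close>)
    also have "KS * (c * (v \<bullet> d)) \<le> 1 / h * (v \<bullet> d)"
      using mult_right_mono[OF h3 vd0] by (simp add: c_def mult_ac)
    finally have "d \<bullet> (S *\<^sub>v d) \<le> (v \<bullet> d) / h" using KS(1) by simp
    thus "v \<bullet> (ric A S Q (P - D) *\<^sub>v v) \<le> 0" unfolding expand using 1 by linarith
  qed
qed

lemma compact_bounded_functions: "compact {p :: 'a \<Rightarrow> real. \<forall>x. \<bar>p x\<bar> \<le> l}"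
proof -
  have "compactin (product_topology (\<lambda>_. euclideanreal) UNIV) (PiE UNIV (\<lambda>_ :: 'a. {-l..l}))"
    unfolding compactin_PiE by auto
  moreover have "PiE UNIV (\<lambda>_ :: 'a. {-l..l}) = {p :: 'a \<Rightarrow> real. \<forall>x. \<bar>p x\<bar> \<le> l}"
    by (auto simp: PiE_def abs_le_iff minus_le_iff)
  ultimately show ?thesis by (simp add: euclidean_product_topology)
qed

text \<open>The kernel of \<open>P\<close> consists of states that the output does not see: for \<open>P v = 0\<close> the inequality
reduces to \<open>v \<bullet> Q v \<le> 0\<close>, hence \<open>v\<close> is a maximum of the nonpositive form of \<open>ric P\<close>, and
\<open>ric P v = 0\<close> says \<open>P (A v) = 0\<close>.  So the kernel is invariant under \<open>A\<close> and
contained in the kernel of \<open>Q\<close>, and observability makes it trivial.\<close>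

lemma riccati_inequality_solution_posdef:
  assumes A: "A \<in> carrier_mat n n" and S: "S \<in> carrier_mat n n" "S\<^sup>T = S" and Q: "psd n Q"
    and obs: "\<And>v. v \<in> carrier_vec n \<Longrightarrow> v \<bullet> (Q *\<^sub>v v) = 0
        \<Longrightarrow> (A *\<^sub>v v) \<bullet> (Q *\<^sub>v (A *\<^sub>v v)) = 0 \<Longrightarrow> v = 0\<^sub>v n"
    and P: "psd n P" and le: "\<And>v. v \<in> carrier_vec n \<Longrightarrow> v \<bullet> (ric A S Q P *\<^sub>v v) \<le> 0"
  shows "sym_pos_def n P"
proof -
  have Pc: "P \<in> carrier_mat n n" "P\<^sup>T = P" and Qc: "Q \<in> carrier_mat n n" "Q\<^sup>T = Q"
    using P Q by (auto simp: psd_def)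
  define R where "R = ric A S Q P"
  have Rc: "R \<in> carrier_mat n n" using A S Qc Pc by (simp add: R_def)
  have Rpsd: "psd n (- R)"
    unfolding psd_def
  proof (intro conjI ballI)
    show "(- R)\<^sup>T = - R" unfolding R_def transpose_uminus ric_symmetric[OF A S Qc Pc] ..
    fix v :: "real vec" assume v: "v \<in> carrier_vec n"
    hence "v \<bullet> (- R *\<^sub>v v) = - (v \<bullet> (R *\<^sub>v v))" using Rc by simp
    thus "0 \<le> v \<bullet> (- R *\<^sub>v v)" using le[OF v] by (simp add: R_def)
  qed (use Rc in simp)
  have key: "v \<bullet> (Q *\<^sub>v v) = 0 \<and> P *\<^sub>v (A *\<^sub>v v) = 0\<^sub>v n"
    if v: "v \<in> carrier_vec n" and Pv: "P *\<^sub>v v = 0\<^sub>v n" for v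
  proof -
    have Av: "A *\<^sub>v v \<in> carrier_vec n" using A v by simp
    have z: "M *\<^sub>v 0\<^sub>v n = (0\<^sub>v n :: real vec)" if "M \<in> carrier_mat n n" for M :: "real mat"
      using that by (intro eq_vecI) auto
    have "v \<bullet> (R *\<^sub>v v) = v \<bullet> (Q *\<^sub>v v)"
      unfolding R_def ric_quadform[OF A S(1) Qc(1) Pc v] Pv z[OF S(1)] using Av by simp
    hence q: "v \<bullet> (Q *\<^sub>v v) = 0" using le[OF v] Q v by (simp add: R_def psd_def order_antisym)
    have Qv: "Q *\<^sub>v v = 0\<^sub>v n" by (rule psd_zero_imp_kernel[OF Q v q])
    have "v \<bullet> (- R *\<^sub>v v) = 0" using \<open>v \<bullet> (R *\<^sub>v v) = v \<bullet> (Q *\<^sub>v v)\<close> q v Rc by simp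
    from psd_zero_imp_kernel[OF Rpsd v this] have "- R *\<^sub>v v = 0\<^sub>v n" .
    hence R0: "R *\<^sub>v v = 0\<^sub>v n" using v Rc
      by (metis carrier_matD(2) carrier_vecD uminus_mult_mat_vec uminus_uminus_vec uminus_zero_vec)
    have "R *\<^sub>v v = P *\<^sub>v (A *\<^sub>v v)"
      unfolding R_def ric_mult_vec[OF A S(1) Qc(1) Pc(1) v] Pv Qv z[OF S(1)] z[OF Pc(1)]
      using z[of "A\<^sup>T"] A Pc Av by simp
    thus ?thesis using R0 q by simp
  qed
  show ?thesis
    unfolding sym_pos_def_def
  proof (intro conjI ballI impI Pc)
    fix v :: "real vec" assume v: "v \<in> carrier_vec n" "v \<noteq> 0\<^sub>v n"
    have "v \<bullet> (P *\<^sub>v v) \<noteq> 0"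
    proof
      assume "v \<bullet> (P *\<^sub>v v) = 0"
      hence Pv: "P *\<^sub>v v = 0\<^sub>v n" by (rule psd_zero_imp_kernel[OF P v(1)])
      have "A *\<^sub>v v \<in> carrier_vec n" using A v by simp
      with key[OF v(1) Pv] key[of "A *\<^sub>v v"] obs[OF v(1)] v(2) show False by blast
    qed
    thus "0 < v \<bullet> (P *\<^sub>v v)" using P v by (simp add: psd_def order_less_le)
  qed
qed

text \<open>The solutions of the inequality between \<open>0\<close> and \<open>X\<close> form a compact set, on which the trace has
a minimum; the descent step shows that a minimiser solves the equation.  Matrices are coded by their
entries, extended by zero, so that compactness is that of a product of intervals.\<close>

lemma riccati_inequality_imp_equation:
  assumes A: "A \<in> carrier_mat n n" and S: "S \<in> carrier_mat n n" "S\<^sup>T = S" and Q: "psd n Q"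
    and obs: "\<And>v. v \<in> carrier_vec n \<Longrightarrow> v \<bullet> (Q *\<^sub>v v) = 0
        \<Longrightarrow> (A *\<^sub>v v) \<bullet> (Q *\<^sub>v (A *\<^sub>v v)) = 0 \<Longrightarrow> v = 0\<^sub>v n"
    and X: "psd n X" and le: "\<And>v. v \<in> carrier_vec n \<Longrightarrow> v \<bullet> (ric A S Q X *\<^sub>v v) \<le> 0"
  obtains P where "sym_pos_def n P" "ric A S Q P = 0\<^sub>m n n"
proof -
  have Xc: "X \<in> carrier_mat n n" and Qc: "Q \<in> carrier_mat n n" "Q\<^sup>T = Q"
    using X Q by (auto simp: psd_def)
  define mt :: "(nat \<times> nat \<Rightarrow> real) \<Rightarrow> real mat" where "mt p = mat n n p" for p
  define tr where "tr p = (\<Sum>i<n. p (i, i))" for p :: "nat \<times> nat \<Rightarrow> real"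
  define good where "good P \<longleftrightarrow> psd n P \<and>
    (\<forall>v\<in>carrier_vec n. v \<bullet> (P *\<^sub>v v) \<le> v \<bullet> (X *\<^sub>v v) \<and> v \<bullet> (ric A S Q P *\<^sub>v v) \<le> 0)" for P
  define supp where "supp p \<longleftrightarrow> (\<forall>i j. \<not> (i < n \<and> j < n) \<longrightarrow> p (i, j) = 0)"
    for p :: "nat \<times> nat \<Rightarrow> real"
  define K where "K = {p. supp p \<and> good (mt p)}"
  define entries where "entries P = (\<lambda>(i, j). if i < n \<and> j < n then P $$ (i, j) else 0)"
    for P :: "real mat"
  have mtc [simp]: "mt p \<in> carrier_mat n n" for p by (simp add: mt_def)
  have entries: "mt (entries P) = P" "supp (entries P)" if "P \<in> carrier_mat n n" for P
    using that by (auto simp: mt_def entries_def supp_def)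
  have entriesK: "entries P \<in> K" if "good P" for P
    using entries[of P] that by (auto simp: K_def good_def psd_def)
  obtain l where l: "l > 0" "\<And>v. v \<in> carrier_vec n \<Longrightarrow> \<bar>v \<bullet> (X *\<^sub>v v)\<bar> \<le> l * (v \<bullet> v)"
    using quadform_bounded[OF Xc] by blast
  have bounded: "K \<subseteq> {p. \<forall>x. \<bar>p x\<bar> \<le> l}"
  proof safe
    fix p i j assume p: "p \<in> K"
    show "\<bar>p (i, j)\<bar> \<le> l"
    proof (cases "i < n \<and> j < n")
      case True
      have "\<bar>mt p $$ (i, j)\<bar> \<le> l"
      proof (rule psd_entry_le)
        fix v :: "real vec" assume v: "v \<in> carrier_vec n"
        thus "v \<bullet> (mt p *\<^sub>v v) \<le> l * (v \<bullet> v)"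
          using l(2)[OF v] p by (force simp: K_def good_def)
      qed (use p l True in \<open>auto simp: K_def good_def\<close>)
      thus ?thesis using True by (simp add: mt_def)
    qed (use p l in \<open>auto simp: K_def supp_def\<close>)
  qed
  have "closed K"
  proof -
    have closed_Collect_bounded_all: "closed {p. \<forall>v\<in>carrier_vec n. \<phi> v p}"
      if "\<And>v. v \<in> carrier_vec n \<Longrightarrow> closed {p. \<phi> v p}"
      for \<phi> :: "real vec \<Rightarrow> (nat \<times> nat \<Rightarrow> real) \<Rightarrow> bool"
      using that by (simp add: Collect_ball_eq closed_INT)
    have coord [continuous_intros]: "continuous_on UNIV (\<lambda>p :: nat \<times> nat \<Rightarrow> real. p x)" for x
      by (rule continuous_on_product_coordinates)
    have quad: "continuous_on UNIV (\<lambda>p. v \<bullet> (mt p *\<^sub>v v))" if "v \<in> carrier_vec n" for v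
      using that unfolding mt_def scalar_prod_def
      by (simp add: scalar_prod_def) (intro continuous_intros)
    define rq where "rq v p = 2 * ((mt p *\<^sub>v v) \<bullet> (A *\<^sub>v v))
      + (mt p *\<^sub>v v) \<bullet> (S *\<^sub>v (mt p *\<^sub>v v)) + v \<bullet> (Q *\<^sub>v v)" for v p
    have rquad: "continuous_on UNIV (rq v)" if "v \<in> carrier_vec n" for v
      using that A S Qc unfolding rq_def[abs_def] mt_def scalar_prod_def
      by (simp add: scalar_prod_def) (intro continuous_intros)
    have "K = {p. supp p \<and> (\<forall>i<n. \<forall>j<n. p (i, j) = p (j, i)) \<and>
      (\<forall>v\<in>carrier_vec n. 0 \<le> v \<bullet> (mt p *\<^sub>v v) \<and> v \<bullet> (mt p *\<^sub>v v) \<le> v \<bullet> (X *\<^sub>v v) \<and> rq v p \<le> 0)}"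
    proof -
      have sym: "(mt p)\<^sup>T = mt p \<longleftrightarrow> (\<forall>i<n. \<forall>j<n. p (i, j) = p (j, i))" for p
        by (auto simp: mt_def mat_eq_iff)
      have "v \<bullet> (ric A S Q (mt p) *\<^sub>v v) = rq v p" if "(mt p)\<^sup>T = mt p" "v \<in> carrier_vec n" for v p
        unfolding rq_def using ric_quadform[OF A S(1) Qc(1) mtc that] .
      thus ?thesis unfolding K_def good_def psd_def sym[symmetric] by auto
    qed
    also have "closed \<dots>"
      unfolding supp_def
      by (intro closed_Collect_bounded_all closed_Collect_conj closed_Collect_all closed_Collect_imp
          closed_Collect_eq closed_Collect_le open_Collect_const coord quad rquad continuous_on_const)
        auto
    finally show ?thesis .
  qed
  hence "compact K"
    using compact_Int_closed[OF compact_bounded_functions[of l] \<open>closed K\<close>] bounded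
    by (simp add: Int_absorb1)
  moreover have "good X" using X le by (simp add: good_def)
  hence "K \<noteq> {}" using entriesK by blast
  moreover have "continuous_on K tr"
    unfolding tr_def[abs_def]
    by (intro continuous_on_sum continuous_on_subset[OF continuous_on_product_coordinates]) simp
  ultimately obtain p where p: "p \<in> K" and min: "\<And>q. q \<in> K \<Longrightarrow> tr p \<le> tr q"
    using continuous_attains_inf[of K tr] by blast
  define P where "P = mt p"
  have good: "good P" using p by (simp add: K_def P_def)
  have Ppsd: "psd n P" and Ple: "\<And>v. v \<in> carrier_vec n \<Longrightarrow> v \<bullet> (ric A S Q P *\<^sub>v v) \<le> 0"
    using good by (auto simp: good_def)
  have Ppos: "sym_pos_def n P"
    by (rule riccati_inequality_solution_posdef[OF A S Q obs Ppsd Ple])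
  have "ric A S Q P = 0\<^sub>m n n"
  proof (rule ccontr)
    assume ne: "ric A S Q P \<noteq> 0\<^sub>m n n"
    obtain D where D: "psd n D" "D \<noteq> 0\<^sub>m n n" "psd n (P - D)"
      "\<And>v. v \<in> carrier_vec n \<Longrightarrow> v \<bullet> (ric A S Q (P - D) *\<^sub>v v) \<le> 0"
      using riccati_inequality_descent[OF A S Qc Ppos Ple ne] by blast
    have c: "P \<in> carrier_mat n n" "D \<in> carrier_mat n n" using Ppsd D(1) by (auto simp: psd_def)
    have "good (P - D)"
      unfolding good_def
    proof (intro conjI ballI D)
      fix v :: "real vec" assume v: "v \<in> carrier_vec n"
      have "v \<bullet> ((P - D) *\<^sub>v v) = v \<bullet> (P *\<^sub>v v) - v \<bullet> (D *\<^sub>v v)"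
        using c v by (simp add: minus_mult_distrib_mat_vec[of _ n n] scalar_prod_minus_distrib[of _ n])
      moreover have "0 \<le> v \<bullet> (D *\<^sub>v v)" using D(1) v by (simp add: psd_def)
      moreover have "v \<bullet> (P *\<^sub>v v) \<le> v \<bullet> (X *\<^sub>v v)" using good v by (simp add: good_def)
      ultimately show "v \<bullet> ((P - D) *\<^sub>v v) \<le> v \<bullet> (X *\<^sub>v v)" by linarith
    qed
    hence "tr p \<le> tr (entries (P - D))" by (intro min entriesK)
    also have "\<dots> = tr p - (\<Sum>i<n. D $$ (i, i))"
      using c by (simp add: tr_def entries_def P_def mt_def sum_subtractf)
    finally have "D = 0\<^sub>m n n" by (intro psd_trace_zero_imp_zero[OF D(1)]) simp
    thus False using D(2) by simp
  qed
  thus thesis using that Ppos by blast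
qed

section \<open>Bessel inequality for the control coefficients\<close>

definition sin_sin_primitive :: "nat \<Rightarrow> nat \<Rightarrow> real \<Rightarrow> real" where
  "sin_sin_primitive n m x =
     (if n = m then x / 2 - sin (2 * real n * x) / (4 * real n)
      else (sin ((real n - real m) * x) / (real n - real m)
            - sin ((real n + real m) * x) / (real n + real m)) / 2)"

lemma has_real_derivative_sin_sin_primitive:
  assumes "n \<ge> 1" "m \<ge> 1"
  shows "(sin_sin_primitive n m has_real_derivative sin (real n * x) * sin (real m * x)) (at x)"
proof (cases "n = m")
  case True
  have "((\<lambda>x. x / 2 - sin (2 * real n * x) / (4 * real n)) has_real_derivative
      1 / 2 - cos (2 * real n * x) * (2 * real n) / (4 * real n)) (at x)"
    by (auto intro!: derivative_eq_intros)
  moreover have "1 / 2 - cos (2 * real n * x) * (2 * real n) / (4 * real n) = sin (real n * x) * sin (real n * x)"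
    using assms cos_double_sin[of "real n * x"] by (simp add: power2_eq_square mult_ac field_simps)
  ultimately show ?thesis using True unfolding sin_sin_primitive_def[abs_def] by simp
next
  case False
  hence nz: "real n - real m \<noteq> 0" "real n + real m \<noteq> 0" using assms by auto
  have sin_scaled: "((\<lambda>x. sin (k * x)) has_real_derivative cos (k * x) * k) (at x)" for k :: real
    by (auto intro!: derivative_eq_intros)
  have "((\<lambda>x. (sin ((real n - real m) * x) / (real n - real m)
            - sin ((real n + real m) * x) / (real n + real m)) / 2) has_real_derivative
      (cos ((real n - real m) * x) * (real n - real m) / (real n - real m)
        - cos ((real n + real m) * x) * (real n + real m) / (real n + real m)) / 2) (at x)"
    by (intro DERIV_cdivide DERIV_diff sin_scaled)
  moreover have "(cos ((real n - real m) * x) * (real n - real m) / (real n - real m)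
        - cos ((real n + real m) * x) * (real n + real m) / (real n + real m)) / 2
      = sin (real n * x) * sin (real m * x)"
    using nz by (simp add: sin_times_sin distrib_right left_diff_distrib)
  ultimately show ?thesis using False unfolding sin_sin_primitive_def[abs_def] by simp
qed

lemma sin_sin_primitive_0_pi:
  assumes "n \<ge> 1" "m \<ge> 1"
  shows "sin_sin_primitive n m pi - sin_sin_primitive n m 0 = (if n = m then pi / 2 else 0)"
proof -
  have "sin (2 * real n * pi) = 0" using sin_npi[of "2 * n"] by simp
  moreover have "sin ((real n - real m) * pi) = 0" "sin ((real n + real m) * pi) = 0"
    by (simp_all add: distrib_right left_diff_distrib sin_add sin_diff)
  ultimately show ?thesis by (simp add: sin_sin_primitive_def)
qed

text \<open>With \<open>s\<close> the sine polynomial of the Fourier coefficients \<open>c n\<close> of the indicator of \<open>[a, b]\<close>, this is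
\<open>0 \<le> \<integral>\<^sub>a\<^sup>b (1 - s)\<^sup>2\<close> combined with \<open>\<integral>\<^sub>a\<^sup>b s\<^sup>2 \<le> \<integral>\<^sub>0\<^sup>\<pi> s\<^sup>2\<close>.  The integrals are expressed
through explicit primitives: \<open>G\<close> is one of \<open>s\<^sup>2\<close> and \<open>H\<close> one of \<open>(1 - s)\<^sup>2\<close>, so both are monotone.\<close>

lemma indicator_sine_bessel:
  assumes "0 \<le> a" "a \<le> b" "b \<le> pi"
  shows "(2 / pi) * (\<Sum>n = 1..M. ((cos (real n * b) - cos (real n * a)) / real n)\<^sup>2) \<le> b - a"
proof -
  define c where "c n = 2 / pi * ((cos (real n * a) - cos (real n * b)) / real n)" for n :: nat
  define s where "s x = (\<Sum>n = 1..M. c n * sin (real n * x))" for x :: real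
  define G where "G x = (\<Sum>n = 1..M. \<Sum>m = 1..M. c n * c m * sin_sin_primitive n m x)" for x :: real
  define H where "H x = x - 2 * (\<Sum>n = 1..M. c n * (- cos (real n * x) / real n)) + G x" for x :: real
  have dG: "(G has_real_derivative (s x)\<^sup>2) (at x)" for x
  proof -
    have "(G has_real_derivative
       (\<Sum>n = 1..M. \<Sum>m = 1..M. c n * c m * (sin (real n * x) * sin (real m * x)))) (at x)"
      unfolding G_def[abs_def]
      by (intro DERIV_sum DERIV_cmult has_real_derivative_sin_sin_primitive) auto
    moreover have "(\<Sum>n = 1..M. \<Sum>m = 1..M. c n * c m * (sin (real n * x) * sin (real m * x))) = (s x)\<^sup>2"
      unfolding s_def power2_eq_square sum_product by (intro sum.cong refl) (simp add: mult_ac)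
    ultimately show ?thesis by simp
  qed
  have dH: "(H has_real_derivative (1 - s x)\<^sup>2) (at x)" for x
  proof -
    have "((\<lambda>x. - cos (real n * x) / real n) has_real_derivative sin (real n * x)) (at x)" if "n \<ge> 1" for n
      by (rule derivative_eq_intros refl | use that in simp)+
    hence "((\<lambda>x. \<Sum>n = 1..M. c n * (- cos (real n * x) / real n)) has_real_derivative s x) (at x)"
      unfolding s_def by (intro DERIV_sum DERIV_cmult) auto
    hence "(H has_real_derivative (1 - 2 * s x + (s x)\<^sup>2)) (at x)"
      unfolding H_def[abs_def] by (intro DERIV_add DERIV_diff DERIV_ident DERIV_cmult dG)
    thus ?thesis by (simp add: power2_eq_square algebra_simps)
  qed
  have G_mono: "G x \<le> G y" if "x \<le> y" for x y
    using that by (rule DERIV_nonneg_imp_nondecreasing) (use dG in \<open>blast intro: zero_le_power2\<close>)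
  have "H a \<le> H b"
    using assms(2) by (rule DERIV_nonneg_imp_nondecreasing) (use dH in \<open>blast intro: zero_le_power2\<close>)
  moreover have "H b - H a = (b - a) - pi * (\<Sum>n = 1..M. (c n)\<^sup>2) + (G b - G a)"
  proof -
    have "(\<Sum>n = 1..M. c n * (- cos (real n * b) / real n)) - (\<Sum>n = 1..M. c n * (- cos (real n * a) / real n))
       = pi / 2 * (\<Sum>n = 1..M. (c n)\<^sup>2)"
      unfolding sum_subtractf[symmetric] sum_distrib_left
      by (intro sum.cong refl) (simp add: c_def power2_eq_square field_simps)
    thus ?thesis by (simp add: H_def algebra_simps)
  qed
  moreover have "G pi - G 0 = pi / 2 * (\<Sum>n = 1..M. (c n)\<^sup>2)"
  proof -
    have "G pi - G 0 = (\<Sum>n = 1..M. \<Sum>m = 1..M. c n * c m * (if n = m then pi / 2 else 0))"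
      unfolding G_def sum_subtractf[symmetric] right_diff_distrib[symmetric]
      by (intro sum.cong refl arg_cong2[where f = "(*)"] sin_sin_primitive_0_pi) auto
    also have "\<dots> = (\<Sum>n = 1..M. pi / 2 * (c n)\<^sup>2)"
      by (intro sum.cong refl) (simp add: if_distrib power2_eq_square cong: if_cong)
    finally show ?thesis by (simp add: sum_distrib_left)
  qed
  moreover have "G b \<le> G pi" "G 0 \<le> G a" using G_mono assms by auto
  ultimately have "pi / 2 * (\<Sum>n = 1..M. (c n)\<^sup>2) \<le> b - a" by (simp add: algebra_simps)
  moreover have "pi / 2 * (\<Sum>n = 1..M. (c n)\<^sup>2)
      = 2 / pi * (\<Sum>n = 1..M. ((cos (real n * b) - cos (real n * a)) / real n)\<^sup>2)"
    unfolding sum_distrib_left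
    by (intro sum.cong refl) (simp add: c_def power2_eq_square field_simps)
  ultimately show ?thesis by simp
qed

text \<open>If the sequences \<open>cos (n a)\<close> and \<open>cos (n b)\<close> agreed from some point on, their recurrence
\<open>2 cos x cos (n x) = cos ((n + 1) x) + cos ((n - 1) x)\<close> and \<open>cos a \<noteq> cos b\<close> would make
\<open>cos (n a)\<close> vanish for all large \<open>n\<close>, contradicting \<open>cos (2 n a) = 2 cos\<^sup>2 (n a) - 1\<close>.\<close>

lemma cos_multiples_eventually_differ:
  assumes "0 \<le> a" "a < b" "b \<le> pi"
  obtains n where "n > M" "cos (real n * a) \<noteq> cos (real n * b)"
proof (rule ccontr)
  assume "\<not> thesis"
  with that have eq: "cos (real n * a) = cos (real n * b)" if "n > M" for n using that by blast
  have ab: "cos a \<noteq> cos b" using cos_monotone_0_pi[of a b] assms by simp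
  have zero: "cos (real n * a) = 0" if "n > Suc M" for n
  proof -
    have 1: "2 * cos x * cos (real n * x) = cos (real (n + 1) * x) + cos (real (n - 1) * x)" for x
      using that cos_add[of "real n * x" x] cos_diff[of "real n * x" x]
      by (simp add: of_nat_diff algebra_simps)
    have "2 * cos a * cos (real n * a) = 2 * cos b * cos (real n * b)"
      unfolding 1 using eq[of "n + 1"] eq[of "n - 1"] that by simp
    hence "cos a * cos (real n * a) = cos b * cos (real n * a)" using eq[of n] that by simp
    thus ?thesis using ab by simp
  qed
  have "cos (real (2 * (M + 2)) * a) = 2 * (cos (real (M + 2) * a))\<^sup>2 - 1"
    using cos_double_cos[of "real (M + 2) * a"] by (simp add: algebra_simps)
  thus False using zero[of "M + 2"] zero[of "2 * (M + 2)"] by simp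
qed

lemma bcoef_omega_quotient:
  "(bcoef xL xR n)\<^sup>2 / (omega n)\<^sup>2 = 2 / pi * ((cos (real n * xR) - cos (real n * xL)) / real n)\<^sup>2"
  by (cases "n = 0") (simp_all add: bcoef_def omega_def power_mult_distrib power_divide field_simps power2_eq_square)

lemma bcoef_bessel_strict:
  assumes "0 \<le> xL" "xL < xR" "xR \<le> pi"
  shows "(\<Sum>n = 1..M. (bcoef xL xR n)\<^sup>2 / (omega n)\<^sup>2) < xR - xL"
proof -
  let ?f = "\<lambda>n. (bcoef xL xR n)\<^sup>2 / (omega n)\<^sup>2"
  obtain m where m: "m > M" "cos (real m * xL) \<noteq> cos (real m * xR)"
    using cos_multiples_eventually_differ[OF assms] .
  have "0 < ?f m" using m unfolding bcoef_omega_quotient by simp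
  hence "sum ?f {1..M} < sum ?f (insert m {1..M})" using m by simp
  also have "\<dots> \<le> sum ?f {1..m}" by (rule sum_mono2) (use m in auto)
  also have "\<dots> \<le> xR - xL"
    unfolding bcoef_omega_quotient sum_distrib_left[symmetric]
    by (rule indicator_sine_bessel) (use assms in auto)
  finally show ?thesis .
qed

section \<open>The remainder weight when a mode is added\<close>

text \<open>This is the monotonicity of \<open>C\<^sub>M\<close> in \<open>t = \<omega>\<^sup>2\<close>: its reciprocal is \<open>t / (1 + r t) - g / t\<close>, which increases.\<close>

lemma mode_gain_antimono:
  fixes s t r g :: real
  assumes "0 < s" "s \<le> t" "0 \<le> r" "0 \<le> g" and pos: "0 < s\<^sup>2 - (1 + r * s) * g"
  shows "0 < t\<^sup>2 - (1 + r * t) * g"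
    and "t * (1 + r * t) / (t\<^sup>2 - (1 + r * t) * g) \<le> s * (1 + r * s) / (s\<^sup>2 - (1 + r * s) * g)"
proof -
  have t0: "0 < t" using assms by simp
  have "s * ((1 + r * t) * g) \<le> t * ((1 + r * s) * g)"
  proof -
    have "s * (1 + r * t) \<le> t * (1 + r * s)" using assms by (simp add: algebra_simps)
    thus ?thesis using \<open>0 \<le> g\<close> by (metis mult.assoc mult_right_mono)
  qed
  also have "\<dots> < t * s\<^sup>2" using pos t0 by simp
  also have "\<dots> \<le> s * t\<^sup>2" using assms t0 by (simp add: power2_eq_square mult_ac)
  finally show tpos: "0 < t\<^sup>2 - (1 + r * t) * g" using \<open>0 < s\<close> by simp
  have "t * (1 + r * t) * (s\<^sup>2 - (1 + r * s) * g) \<le> s * (1 + r * s) * (t\<^sup>2 - (1 + r * t) * g)"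
  proof -
    have "s * (1 + r * s) * (t\<^sup>2 - (1 + r * t) * g) - t * (1 + r * t) * (s\<^sup>2 - (1 + r * s) * g)
      = (t - s) * (s * t + (1 + r * s) * (1 + r * t) * g)"
      by (simp add: power2_eq_square algebra_simps)
    moreover have "0 \<le> (t - s) * (s * t + (1 + r * s) * (1 + r * t) * g)"
      using assms t0 by (intro mult_nonneg_nonneg add_nonneg_nonneg) auto
    ultimately show ?thesis by linarith
  qed
  thus "t * (1 + r * t) / (t\<^sup>2 - (1 + r * t) * g) \<le> s * (1 + r * s) / (s\<^sup>2 - (1 + r * s) * g)"
    using pos tpos by (simp add: divide_simps mult_ac)
qed

text \<open>\<open>2 \<zeta>\<^sup>2 > 1\<close> holds once \<open>\<omega>\<close> exceeds the larger root of \<open>c\<^sub>2 \<omega>\<^sup>2 - \<surd>2 \<omega> + c\<^sub>1\<close>, and the integer part in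
the definition of \<open>M\<close> is the largest mode for which \<open>\<omega> = n\<^sup>2\<close> does not exceed this root.\<close>

lemma large_mode_overdamped:
  assumes c: "c1 > 0" "c2 > 0" "c1 + c2 \<le> sqrt 2" and M: "Mnum c1 c2 N = N"
  shows "2 * (zeta c1 c2 (N + 1))\<^sup>2 > 1"
proof -
  define r where "r = (1 + sqrt (1 - 2 * c1 * c2)) / (sqrt 2 * c2)"
  define w where "w = omega (N + 1)"
  have "4 * (c1 * c2) \<le> (c1 + c2)\<^sup>2" using sum_squares_bound[of c1 c2] by (simp add: power2_sum)
  also have "\<dots> \<le> (sqrt 2)\<^sup>2" by (rule power_mono) (use c in auto)
  finally have cc: "0 \<le> 1 - 2 * c1 * c2" by simp
  have r0: "0 < r" using c cc unfolding r_def by (intro divide_pos_pos add_pos_nonneg) auto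
  have "nat \<lfloor>sqrt r\<rfloor> \<le> N" using M unfolding Mnum_def r_def by simp
  hence "\<lfloor>sqrt r\<rfloor> < int N + 1" by linarith
  hence "sqrt r < real (N + 1)" by linarith
  hence "(sqrt r)\<^sup>2 < (real (N + 1))\<^sup>2" using r0 by (intro power_strict_mono) auto
  hence rw: "r < w" using r0 by (simp add: w_def omega_def)
  have w0: "0 < w" using r0 rw by simp
  define q where "q = sqrt (1 - 2 * c1 * c2)"
  have q: "q\<^sup>2 = 1 - 2 * c1 * c2" "0 \<le> q" using cc by (auto simp: q_def)
  have "q < sqrt 2 * c2 * w - 1" using rw c unfolding r_def q_def[symmetric] by (simp add: field_simps)
  hence "q\<^sup>2 < (sqrt 2 * c2 * w - 1)\<^sup>2" using q(2) by (intro power_strict_mono) auto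
  hence "1 - 2 * c1 * c2 < 2 * c2\<^sup>2 * w\<^sup>2 - 2 * sqrt 2 * c2 * w + 1"
    unfolding q by (simp add: power2_diff power_mult_distrib)
  hence "2 * c2 * (sqrt 2 * w) < 2 * c2 * (c1 + c2 * w\<^sup>2)"
    by (simp add: power2_eq_square algebra_simps)
  hence "sqrt 2 * w < c1 + c2 * w\<^sup>2" using c by simp
  hence "sqrt 2 < c1 * inverse w + c2 * w" using w0 by (simp add: field_simps power2_eq_square)
  hence "(sqrt 2)\<^sup>2 < (c1 * inverse w + c2 * w)\<^sup>2" by (intro power_strict_mono) auto
  thus ?thesis by (simp add: zeta_def w_def power_divide)
qed

lemma rho_large_mode:
  assumes "2 * (zeta c1 c2 (M + 1))\<^sup>2 > 1"
  shows "rho_denom c1 c2 \<rho>x \<gamma> (M + 1) = CM_denom \<rho>x \<gamma> M"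
    and "rho c1 c2 xL xR \<rho>x \<gamma> (M + 1)
      = CM \<rho>x \<gamma> M * ((bcoef xL xR (M + 1))\<^sup>2 / (omega (M + 1))\<^sup>2)"
proof -
  show 1: "rho_denom c1 c2 \<rho>x \<gamma> (M + 1) = CM_denom \<rho>x \<gamma> M"
    using assms by (simp add: rho_denom_def CM_denom_def)
  show "rho c1 c2 xL xR \<rho>x \<gamma> (M + 1)
      = CM \<rho>x \<gamma> M * ((bcoef xL xR (M + 1))\<^sup>2 / (omega (M + 1))\<^sup>2)"
    unfolding rho_def 1 CM_def by (simp add: omega_def)
qed

lemma CM_Suc:
  assumes "CM_denom \<rho>x \<gamma> M > 0" "\<rho>x \<ge> 0"
  shows "CM_denom \<rho>x \<gamma> (M + 1) > 0" "CM \<rho>x \<gamma> (M + 1) \<le> CM \<rho>x \<gamma> M"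
proof -
  let ?s = "(omega (M + 1))\<^sup>2" and ?t = "(omega (M + 1 + 1))\<^sup>2"
  have *: "0 < ?s" "?s \<le> ?t" "0 \<le> \<rho>x" "0 \<le> inverse (\<gamma>\<^sup>2)"
    "0 < ?s\<^sup>2 - (1 + \<rho>x * ?s) * inverse (\<gamma>\<^sup>2)"
    using assms by (auto simp: omega_def CM_denom_def power_mult[symmetric] intro!: power_mono)
  show "CM_denom \<rho>x \<gamma> (M + 1) > 0" "CM \<rho>x \<gamma> (M + 1) \<le> CM \<rho>x \<gamma> M"
    using mode_gain_antimono[OF *] by (simp_all add: CM_denom_def CM_def power_mult[symmetric])
qed

lemma CM_pos:
  assumes "CM_denom \<rho>x \<gamma> M > 0" "\<rho>x \<ge> 0"
  shows "CM \<rho>x \<gamma> M > 0"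
  using assms unfolding CM_def
  by (intro divide_pos_pos mult_pos_pos add_pos_nonneg) (auto simp: omega_def)

definition denoms_pos :: "real \<Rightarrow> real \<Rightarrow> real \<Rightarrow> real \<Rightarrow> nat \<Rightarrow> bool" where
  "denoms_pos c1 c2 \<rho>x \<gamma> N \<longleftrightarrow>
     (\<forall>n \<in> {N + 1..Mnum c1 c2 N}. rho_denom c1 c2 \<rho>x \<gamma> n > 0) \<and> CM_denom \<rho>x \<gamma> (Mnum c1 c2 N) > 0"

lemma rho_inf_pos:
  assumes "denoms_pos c1 c2 \<rho>x \<gamma> N" "\<rho>x \<ge> 0" "0 < xL" "xL < xR" "xR < pi"
  shows "rho_inf c1 c2 xL xR \<rho>x \<gamma> N > 0"
proof -
  let ?M = "Mnum c1 c2 N"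
  have "CM \<rho>x \<gamma> ?M * (\<bar>xR - xL\<bar> - (\<Sum>n = 1..?M. (bcoef xL xR n)\<^sup>2 / (omega n)\<^sup>2)) > 0"
    using bcoef_bessel_strict[of xL xR ?M] CM_pos assms by (simp add: denoms_pos_def)
  moreover have "(\<Sum>n = N + 1..?M. rho c1 c2 xL xR \<rho>x \<gamma> n) \<ge> 0"
  proof (rule sum_nonneg)
    fix n assume "n \<in> {N + 1..?M}"
    hence "rho_denom c1 c2 \<rho>x \<gamma> n > 0" using assms by (simp add: denoms_pos_def)
    thus "rho c1 c2 xL xR \<rho>x \<gamma> n \<ge> 0" unfolding rho_def
      using assms by (intro divide_nonneg_pos mult_nonneg_nonneg add_nonneg_nonneg) auto
  qed
  ultimately show ?thesis by (simp add: rho_inf_def Let_def)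
qed

text \<open>If \<open>M N > N\<close>, the weight \<open>\<rho> (N + 1)\<close> is the first summand of the finite sum.  If \<open>M N = N\<close>, it is
the term \<open>C\<^sub>N b\<^sup>2 / \<omega>\<^sup>2\<close> that completes the bracket of \<open>N + 1\<close>, and \<open>C\<^sub>N\<^sub>+\<^sub>1 \<le> C\<^sub>N\<close>.\<close>

lemma rho_inf_step:
  assumes c: "c1 > 0" "c2 > 0" "c1 + c2 \<le> sqrt 2"
    and d: "denoms_pos c1 c2 \<rho>x \<gamma> N" and "\<rho>x \<ge> 0" "0 < xL" "xL < xR" "xR < pi"
  shows "denoms_pos c1 c2 \<rho>x \<gamma> (N + 1)" "rho_denom c1 c2 \<rho>x \<gamma> (N + 1) > 0"
    "rho_inf c1 c2 xL xR \<rho>x \<gamma> (N + 1) + rho c1 c2 xL xR \<rho>x \<gamma> (N + 1)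
      \<le> rho_inf c1 c2 xL xR \<rho>x \<gamma> N"
proof -
  let ?b = "\<lambda>n. (bcoef xL xR n)\<^sup>2 / (omega n)\<^sup>2"
  have "denoms_pos c1 c2 \<rho>x \<gamma> (N + 1) \<and> rho_denom c1 c2 \<rho>x \<gamma> (N + 1) > 0 \<and>
    rho_inf c1 c2 xL xR \<rho>x \<gamma> (N + 1) + rho c1 c2 xL xR \<rho>x \<gamma> (N + 1)
      \<le> rho_inf c1 c2 xL xR \<rho>x \<gamma> N"
  proof (cases "Mnum c1 c2 N = N")
    case False
    hence M: "Mnum c1 c2 (N + 1) = Mnum c1 c2 N" and le: "N + 1 \<le> Mnum c1 c2 N"
      by (auto simp: Mnum_def)
    have "(\<Sum>n = N + 1..Mnum c1 c2 N. rho c1 c2 xL xR \<rho>x \<gamma> n)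
      = rho c1 c2 xL xR \<rho>x \<gamma> (N + 1) + (\<Sum>n = N + 1 + 1..Mnum c1 c2 N. rho c1 c2 xL xR \<rho>x \<gamma> n)"
      using sum.atLeast_Suc_atMost[OF le] by simp
    thus ?thesis using d le unfolding denoms_pos_def M rho_inf_def Let_def by auto
  next
    case True
    have M: "Mnum c1 c2 (N + 1) = N + 1" using True by (simp add: Mnum_def)
    have z: "2 * (zeta c1 c2 (N + 1))\<^sup>2 > 1" by (rule large_mode_overdamped[OF c True])
    have d0: "CM_denom \<rho>x \<gamma> N > 0" using d by (simp add: denoms_pos_def True)
    let ?L = "\<bar>xR - xL\<bar> - (\<Sum>n = 1..N + 1. ?b n)"
    have "CM \<rho>x \<gamma> (N + 1) * ?L \<le> CM \<rho>x \<gamma> N * ?L"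
      using CM_Suc(2)[OF d0 \<open>\<rho>x \<ge> 0\<close>] bcoef_bessel_strict[of xL xR "N + 1"] assms
      by (intro mult_right_mono) auto
    also have "\<dots> = CM \<rho>x \<gamma> N * (\<bar>xR - xL\<bar> - (\<Sum>n = 1..N. ?b n)) - CM \<rho>x \<gamma> N * ?b (N + 1)"
      by (simp add: right_diff_distrib distrib_left)
    finally have "CM \<rho>x \<gamma> (N + 1) * ?L + CM \<rho>x \<gamma> N * ?b (N + 1)
      \<le> CM \<rho>x \<gamma> N * (\<bar>xR - xL\<bar> - (\<Sum>n = 1..N. ?b n))" by linarith
    thus ?thesis
      using d0 CM_Suc(1)[OF d0 \<open>\<rho>x \<ge> 0\<close>]
      unfolding denoms_pos_def rho_inf_def Let_def M True rho_large_mode[OF z] by simp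
  qed
  thus "denoms_pos c1 c2 \<rho>x \<gamma> (N + 1)" "rho_denom c1 c2 \<rho>x \<gamma> (N + 1) > 0"
    "rho_inf c1 c2 xL xR \<rho>x \<gamma> (N + 1) + rho c1 c2 xL xR \<rho>x \<gamma> (N + 1)
      \<le> rho_inf c1 c2 xL xR \<rho>x \<gamma> N" by auto
qed

section \<open>Dissipation inequality for one mode\<close>

text \<open>Here \<open>s\<close> and \<open>\<beta>\<close> are the entries of \<open>B\<^sup>T P v\<close> contributed by the old modes and by the new one,
and \<open>m\<close> is the rate of the new mode without control.  The old optimal
control \<open>u = - s / R\<close> is inserted into the new mode; the optimal control for the weight \<open>R'\<close> can
only do better.\<close>

lemma control_exchange:
  fixes R R' \<rho> s \<beta> m :: real
  assumes "R' > 0" "\<rho> + R' \<le> R" "R > 0"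
    and m: "\<And>u. m + 2 * \<beta> * u - \<rho> * u\<^sup>2 \<le> 0"
  shows "inverse R * s\<^sup>2 + m - inverse R' * (s + \<beta>)\<^sup>2 \<le> 0"
proof -
  define u where "u = - (s / R)"
  have s: "s = - (R * u)" using \<open>R > 0\<close> by (simp add: u_def)
  \<comment> \<open>\<open>- (s + \<beta>)\<^sup>2 / R'\<close> is the minimum of \<open>2 (s + \<beta>) u + R' u\<^sup>2\<close> over all \<open>u\<close>\<close>
  have "0 \<le> (s + \<beta> + R' * u)\<^sup>2 / R'" using \<open>R' > 0\<close> by simp
  also have "\<dots> = inverse R' * (s + \<beta>)\<^sup>2 + 2 * (s + \<beta>) * u + R' * u\<^sup>2"
    using \<open>R' > 0\<close> by (simp add: field_simps power2_eq_square)
  finally have 1: "- (inverse R' * (s + \<beta>)\<^sup>2) \<le> 2 * (s + \<beta>) * u + R' * u\<^sup>2" by simp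
  have 2: "inverse R * s\<^sup>2 = R * u\<^sup>2" using \<open>R > 0\<close> by (simp add: s power2_eq_square field_simps)
  have 3: "2 * (s + \<beta>) * u = - 2 * (R * u\<^sup>2) + 2 * \<beta> * u"
    by (simp add: s power2_eq_square algebra_simps)
  have "(\<rho> + R') * u\<^sup>2 \<le> R * u\<^sup>2" using assms(2) by (rule mult_right_mono) simp
  hence "\<rho> * u\<^sup>2 + R' * u\<^sup>2 \<le> R * u\<^sup>2" by (simp add: distrib_right)
  thus ?thesis using m[of u] 1 2 3 by linarith
qed

text \<open>For the oscillator \<open>z'' + d z' + w\<^sup>2 z = f\<close> the storage function with gradient \<open>2 (p, q)\<close> gives the
rate \<open>\<le> \<sigma> f\<^sup>2 - \<kappa> z\<^sup>2\<close>, the defect being the square of \<open>f - \<alpha> z - d y\<close> and the nonpositive term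
\<open>(2 \<alpha> - d\<^sup>2) y\<^sup>2\<close>.  With \<open>f = \<beta> u + v\<close> and the disturbance \<open>v\<close> penalised by \<open>1 / g\<close>, eliminating the worst
\<open>v = g q\<close> leaves a negative semidefinite form in \<open>\<alpha> z + d y\<close> and \<open>u\<close>, again minus a square.\<close>

lemma oscillator_dissipation:
  fixes w d \<alpha> \<kappa> g \<beta> \<Delta>0 \<sigma> :: real
  assumes "\<kappa> > 0" "\<Delta>0 > 0" and \<Delta>0: "\<Delta>0 = 2 * \<alpha> * w\<^sup>2 - \<alpha>\<^sup>2" and "\<Delta>0 - \<kappa> * g > 0"
    and "2 * \<alpha> \<le> d\<^sup>2" and \<sigma>: "\<sigma> = \<kappa> / \<Delta>0"
  defines "p \<equiv> \<lambda>z y. \<sigma> * d * w\<^sup>2 * z + \<sigma> * \<alpha> * y"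
    and "q \<equiv> \<lambda>z y. \<sigma> * \<alpha> * z + \<sigma> * d * y"
  shows "2 * p z y * y + 2 * q z y * (- w\<^sup>2 * z - d * y) + \<kappa> * z\<^sup>2 + g * (q z y)\<^sup>2
    + 2 * (\<beta> * q z y) * u - \<beta>\<^sup>2 * \<kappa> / (\<Delta>0 - \<kappa> * g) * u\<^sup>2 \<le> 0"
proof -
  define r where "r = \<alpha> * z + d * y"
  define \<Delta> where "\<Delta> = \<Delta>0 - \<kappa> * g"
  have \<Delta>: "\<Delta> > 0" using assms by (simp add: \<Delta>_def)
  have \<sigma>0: "\<sigma> > 0" using assms by (simp add: \<sigma>)
  have \<kappa>: "\<kappa> = \<sigma> * \<Delta>0" using \<open>\<Delta>0 > 0\<close> by (simp add: \<sigma>)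
  have q: "q z y = \<sigma> * r" by (simp add: q_def r_def algebra_simps)
  have 1: "2 * p z y * y + 2 * q z y * (- w\<^sup>2 * z - d * y) + \<kappa> * z\<^sup>2
    = - \<sigma> * r\<^sup>2 + \<sigma> * (2 * \<alpha> - d\<^sup>2) * y\<^sup>2"
    unfolding \<kappa> \<Delta>0 p_def q_def r_def by (simp add: power2_eq_square algebra_simps)
  have 2: "\<sigma> * (2 * \<alpha> - d\<^sup>2) * y\<^sup>2 \<le> 0"
    using \<sigma>0 \<open>2 * \<alpha> \<le> d\<^sup>2\<close> by (intro mult_nonpos_nonneg mult_nonneg_nonpos) auto
  have "- \<sigma> * r\<^sup>2 + g * (\<sigma> * r)\<^sup>2 + 2 * (\<beta> * (\<sigma> * r)) * u - \<beta>\<^sup>2 * \<kappa> / \<Delta> * u\<^sup>2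
    = - (\<kappa> / \<Delta>) * (\<Delta> * r / \<Delta>0 - \<beta> * u)\<^sup>2"
  proof -
    have "(\<kappa> / \<Delta>) * (\<Delta> * r / \<Delta>0 - \<beta> * u)\<^sup>2
      = \<kappa> * \<Delta> / \<Delta>0\<^sup>2 * r\<^sup>2 - 2 * (\<beta> * (\<sigma> * r)) * u + \<beta>\<^sup>2 * \<kappa> / \<Delta> * u\<^sup>2"
      using \<Delta> \<open>\<Delta>0 > 0\<close> by (simp add: \<sigma> field_simps power2_eq_square)
    moreover have "\<kappa> * \<Delta> / \<Delta>0\<^sup>2 = \<sigma> - g * \<sigma>\<^sup>2"
      using \<open>\<Delta>0 > 0\<close> by (simp add: \<sigma> \<Delta>_def field_simps power2_eq_square)
    ultimately have "(\<kappa> / \<Delta>) * (\<Delta> * r / \<Delta>0 - \<beta> * u)\<^sup>2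
      = (\<sigma> - g * \<sigma>\<^sup>2) * r\<^sup>2 - 2 * (\<beta> * (\<sigma> * r)) * u + \<beta>\<^sup>2 * \<kappa> / \<Delta> * u\<^sup>2" by simp
    thus ?thesis by (simp only: minus_mult_left[symmetric]) (simp add: power_mult_distrib left_diff_distrib)
  qed
  also have "\<dots> \<le> 0" using \<Delta> \<open>\<kappa> > 0\<close> by (intro mult_nonpos_nonneg) auto
  finally show ?thesis using 1 2 unfolding q \<Delta>_def by linarith
qed

text \<open>The rate of change of the storage function plus the output \<open>(1 + \<rho>x \<omega>\<^sup>2) z\<^sup>2\<close>, for the uncontrolled
mode at position \<open>z\<close> and velocity \<open>y\<close>, where the storage function has gradient \<open>2 (p, q)\<close> and
the disturbance takes its worst value \<open>q / \<gamma>\<^sup>2\<close>, penalised by \<open>\<gamma>\<^sup>2\<close> times its square.\<close>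

definition mode_rate :: "real \<Rightarrow> real \<Rightarrow> real \<Rightarrow> real \<Rightarrow> nat \<Rightarrow> real \<Rightarrow> real \<Rightarrow> real \<Rightarrow> real \<Rightarrow> real" where
  "mode_rate c1 c2 \<rho>x \<gamma> n z y p q =
     2 * p * y + 2 * q * (- (omega n)\<^sup>2 * z - (c1 + c2 * (omega n)\<^sup>2) * y)
     + (1 + \<rho>x * (omega n)\<^sup>2) * z\<^sup>2 + inverse (\<gamma>\<^sup>2) * q\<^sup>2"

text \<open>The two cases of \<open>\<rho> n\<close> are the minimum of \<open>|\<omega>\<^sup>2 - t\<^sup>2 + 2 \<i> \<zeta> \<omega> t|\<^sup>2\<close> over real frequencies \<open>t\<close>, attained at
\<open>t\<^sup>2 = \<omega>\<^sup>2 (1 - 2 \<zeta>\<^sup>2)\<close> or at \<open>t = 0\<close>.  With \<open>\<alpha> = \<omega>\<^sup>2 min (2 \<zeta>\<^sup>2) 1\<close> this minimum is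
\<open>2 \<alpha> \<omega>\<^sup>2 - \<alpha>\<^sup>2\<close> in both cases, so one storage matrix serves both.\<close>

lemma single_mode_storage:
  assumes c: "c1 > 0" "c2 > 0" and "\<rho>x \<ge> 0" "n \<ge> 1"
    and den: "rho_denom c1 c2 \<rho>x \<gamma> n > 0"
  obtains a b c where "\<And>z y. 0 \<le> a * z\<^sup>2 + 2 * b * z * y + c * y\<^sup>2"
    "\<And>z y u. mode_rate c1 c2 \<rho>x \<gamma> n z y (a * z + b * y) (b * z + c * y)
        + 2 * (bcoef xL xR n * (b * z + c * y)) * u - rho c1 c2 xL xR \<rho>x \<gamma> n * u\<^sup>2 \<le> 0"
proof -
  define w where "w = omega n"
  define k where "k = zeta c1 c2 n"
  define d where "d = c1 + c2 * w\<^sup>2"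
  define m where "m = min (2 * k\<^sup>2) 1"
  define \<alpha> where "\<alpha> = w\<^sup>2 * m"
  define \<kappa> where "\<kappa> = 1 + \<rho>x * w\<^sup>2"
  define g where "g = inverse (\<gamma>\<^sup>2)"
  define \<Delta>0 where "\<Delta>0 = 2 * \<alpha> * w\<^sup>2 - \<alpha>\<^sup>2"
  define \<sigma> where "\<sigma> = \<kappa> / \<Delta>0"
  have w: "w > 0" using \<open>n \<ge> 1\<close> by (simp add: w_def omega_def)
  have d: "d = 2 * k * w" using w by (simp add: d_def k_def zeta_def w_def[symmetric] field_simps power2_eq_square)
  have d0: "d > 0" using c w by (simp add: d_def add_pos_nonneg)
  have m: "0 \<le> m" "m \<le> 1" "m \<le> 2 * k\<^sup>2" by (auto simp: m_def)
  have \<kappa>: "\<kappa> > 0" using \<open>\<rho>x \<ge> 0\<close> by (simp add: \<kappa>_def add_pos_nonneg)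
  have den_eq: "rho_denom c1 c2 \<rho>x \<gamma> n = \<Delta>0 - \<kappa> * g"
  proof -
    have "\<Delta>0 = w ^ 4 * (2 * m - m\<^sup>2)"
      by (simp add: \<Delta>0_def \<alpha>_def power2_eq_square power4_eq_xxxx algebra_simps)
    moreover have "w ^ 4 * (2 * m - m\<^sup>2) = (if 2 * k\<^sup>2 \<le> 1 then 4 * w ^ 4 * k\<^sup>2 * (1 - k\<^sup>2) else w ^ 4)"
      by (simp add: m_def min_def power2_eq_square algebra_simps)
    ultimately show ?thesis by (simp add: rho_denom_def w_def k_def \<kappa>_def g_def)
  qed
  have "\<Delta>0 - \<kappa> * g > 0" using den den_eq by simp
  moreover have "\<kappa> * g \<ge> 0" using \<kappa> by (simp add: g_def)
  ultimately have \<Delta>0: "\<Delta>0 > 0" by linarith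
  have \<sigma>: "\<sigma> > 0" using \<Delta>0 \<kappa> by (simp add: \<sigma>_def)
  have \<alpha>1: "2 * \<alpha> \<le> d\<^sup>2"
    using mult_left_mono[OF m(3), of "w\<^sup>2"] by (simp add: \<alpha>_def d power_mult_distrib mult_ac)
  have "m * m \<le> m" using m by (simp add: mult_left_le)
  hence "m\<^sup>2 \<le> 4 * k\<^sup>2" using m by (simp add: power2_eq_square)
  hence \<alpha>2: "\<alpha>\<^sup>2 \<le> d\<^sup>2 * w\<^sup>2"
    using mult_left_mono[of "m\<^sup>2" "4 * k\<^sup>2" "w\<^sup>2 * w\<^sup>2"] w
    by (simp add: \<alpha>_def d power_mult_distrib power2_eq_square mult_ac)
  show ?thesis
  proof (rule that[of "\<sigma> * d * w\<^sup>2" "\<sigma> * \<alpha>" "\<sigma> * d"])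
    fix z y :: real
    have "0 \<le> (d * y + \<alpha> * z)\<^sup>2 + (d\<^sup>2 * w\<^sup>2 - \<alpha>\<^sup>2) * z\<^sup>2" using \<alpha>2 by simp
    also have "\<dots> = d / \<sigma> * (\<sigma> * d * w\<^sup>2 * z\<^sup>2 + 2 * (\<sigma> * \<alpha>) * z * y + \<sigma> * d * y\<^sup>2)"
      using \<sigma> by (simp add: field_simps power2_eq_square)
    finally show "0 \<le> \<sigma> * d * w\<^sup>2 * z\<^sup>2 + 2 * (\<sigma> * \<alpha>) * z * y + \<sigma> * d * y\<^sup>2"
      using d0 \<sigma> by (simp add: zero_le_mult_iff zero_le_divide_iff)
    fix u
    show "mode_rate c1 c2 \<rho>x \<gamma> n z y (\<sigma> * d * w\<^sup>2 * z + \<sigma> * \<alpha> * y) (\<sigma> * \<alpha> * z + \<sigma> * d * y)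
        + 2 * (bcoef xL xR n * (\<sigma> * \<alpha> * z + \<sigma> * d * y)) * u - rho c1 c2 xL xR \<rho>x \<gamma> n * u\<^sup>2 \<le> 0"
      using oscillator_dissipation[OF \<kappa> \<Delta>0 \<Delta>0_def \<open>\<Delta>0 - \<kappa> * g > 0\<close> \<alpha>1 \<sigma>_def, of z y "bcoef xL xR n" u]
      unfolding mode_rate_def rho_def den_eq by (simp add: w_def d_def \<kappa>_def g_def)
  qed
qed

section \<open>The modal matrices in coordinates\<close>

lemma sum_two_halves:
  fixes f :: "nat \<Rightarrow> real"
  shows "(\<Sum>i<2 * n. f i) = (\<Sum>i<n. f i) + (\<Sum>i<n. f (n + i))"
proof -
  have "(\<Sum>i<2 * n. f i) = (\<Sum>i\<in>{0..<n}. f i) + (\<Sum>i\<in>{n..<2 * n}. f i)"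
    by (simp add: lessThan_atLeast0 sum.atLeastLessThan_concat)
  also have "(\<Sum>i\<in>{n..<2 * n}. f i) = (\<Sum>i\<in>{0..<n}. f (n + i))"
    using sum.shift_bounds_nat_ivl[of f 0 n n] by (simp add: mult_2 add.commute)
  finally show ?thesis by (simp add: lessThan_atLeast0)
qed

lemma Omega_mat_square: "Omega_mat n ^\<^sub>m 2 = mat_diag n (\<lambda>i. (omega (i + 1))\<^sup>2)"
  by (simp add: Omega_mat_def numeral_2_eq_2 power2_eq_square)

lemma A_mat_carrier [simp]: "A_mat c1 c2 n \<in> carrier_mat (2 * n) (2 * n)"
  by (rule carrier_matI) (simp_all add: A_mat_def Omega_mat_square mat_diag_def)

lemma B_mat_carrier [simp]: "B_mat xL xR n \<in> carrier_mat (2 * n) 1"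
  by (rule carrier_matI) (simp_all add: B_mat_def append_rows_def)

lemma E_mat_carrier [simp]: "E_mat n \<in> carrier_mat (2 * n) n"
  by (rule carrier_matI) (simp_all add: E_mat_def append_rows_def)

lemma C_mat_carrier [simp]: "C_mat \<rho>x n \<in> carrier_mat (n + 1) (2 * n)"
  by (rule carrier_matI) (simp_all add: C_mat_def Omega_mat_square mat_diag_def)

lemma mult_mat_vec_index:
  assumes "M \<in> carrier_mat m n" "v \<in> carrier_vec n" "i < m"
  shows "(M *\<^sub>v v) $ i = (\<Sum>j<n. M $$ (i, j) * (v $ j :: real))"
  using assms by (simp add: scalar_prod_def lessThan_atLeast0)

lemma transpose_mult_vec_index:
  assumes "M \<in> carrier_mat m n" "v \<in> carrier_vec m" "i < n"
  shows "(M\<^sup>T *\<^sub>v v) $ i = (\<Sum>j<m. M $$ (j, i) * (v $ j :: real))"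
  using assms by (simp add: scalar_prod_def lessThan_atLeast0)

lemma scalar_prod_halves:
  assumes "v \<in> carrier_vec (2 * n)"
  shows "u \<bullet> v = (\<Sum>i<n. u $ i * v $ i) + (\<Sum>i<n. u $ (n + i) * (v $ (n + i) :: real))"
  using assms unfolding scalar_prod_def by (simp add: lessThan_atLeast0[symmetric] sum_two_halves)

lemma if_zero_mult: "(if b then x else 0) * y = (if b then x * y else (0 :: real))"
  by simp

lemma A_mat_index:
  assumes "i < n" "j < n"
  shows "A_mat c1 c2 n $$ (i, j) = 0"
    and "A_mat c1 c2 n $$ (i, n + j) = (if i = j then 1 else 0)"
    and "A_mat c1 c2 n $$ (n + i, j) = (if i = j then - (omega (i + 1))\<^sup>2 else 0)"
    and "A_mat c1 c2 n $$ (n + i, n + j) = (if i = j then - (c1 + c2 * (omega (i + 1))\<^sup>2) else 0)"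
  using assms by (auto simp: A_mat_def Omega_mat_square mat_diag_def)

lemma A_mat_mult_vec:
  assumes v: "v \<in> carrier_vec (2 * n)" and i: "i < n"
  shows "(A_mat c1 c2 n *\<^sub>v v) $ i = v $ (n + i)"
    and "(A_mat c1 c2 n *\<^sub>v v) $ (n + i)
      = - (omega (i + 1))\<^sup>2 * v $ i - (c1 + c2 * (omega (i + 1))\<^sup>2) * v $ (n + i)"
proof -
  have i2: "i < 2 * n" "n + i < 2 * n" using i by auto
  show "(A_mat c1 c2 n *\<^sub>v v) $ i = v $ (n + i)"
    unfolding mult_mat_vec_index[OF A_mat_carrier v i2(1)] sum_two_halves
    using i by (simp add: A_mat_index if_zero_mult)
  show "(A_mat c1 c2 n *\<^sub>v v) $ (n + i)
      = - (omega (i + 1))\<^sup>2 * v $ i - (c1 + c2 * (omega (i + 1))\<^sup>2) * v $ (n + i)"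
    unfolding mult_mat_vec_index[OF A_mat_carrier v i2(2)] sum_two_halves
    using i by (simp add: A_mat_index if_zero_mult left_diff_distrib distrib_right)
qed

lemma B_mat_transpose_mult_vec:
  assumes v: "v \<in> carrier_vec (2 * n)"
  shows "(B_mat xL xR n)\<^sup>T *\<^sub>v v = vec 1 (\<lambda>_. \<Sum>i<n. bcoef xL xR (i + 1) * v $ (n + i))"
proof (rule eq_vecI)
  fix k assume "k < dim_vec (vec 1 (\<lambda>_. \<Sum>i<n. bcoef xL xR (i + 1) * v $ (n + i)))"
  hence k: "k < 1" by simp
  show "((B_mat xL xR n)\<^sup>T *\<^sub>v v) $ k = vec 1 (\<lambda>_. \<Sum>i<n. bcoef xL xR (i + 1) * v $ (n + i)) $ k"
    unfolding transpose_mult_vec_index[OF B_mat_carrier v k] sum_two_halves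
    using k by (simp add: B_mat_def append_rows_def)
qed (use carrier_matD[OF B_mat_carrier[of xL xR n]] in simp)

lemma E_mat_transpose_mult_vec:
  assumes v: "v \<in> carrier_vec (2 * n)"
  shows "(E_mat n)\<^sup>T *\<^sub>v v = vec n (\<lambda>i. v $ (n + i))"
proof (rule eq_vecI)
  fix k assume "k < dim_vec (vec n (\<lambda>i. v $ (n + i)))"
  hence k: "k < n" by simp
  show "((E_mat n)\<^sup>T *\<^sub>v v) $ k = vec n (\<lambda>i. v $ (n + i)) $ k"
    unfolding transpose_mult_vec_index[OF E_mat_carrier v k] sum_two_halves
    using k by (simp add: E_mat_def append_rows_def if_zero_mult)
qed (use carrier_matD[OF E_mat_carrier[of n]] in simp)

lemma C_mat_index:
  assumes "j < n"
  shows "i < n \<Longrightarrow> C_mat \<rho>x n $$ (i, j) = (if i = j then sqrt (1 + \<rho>x * (omega (i + 1))\<^sup>2) else 0)"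
    and "i < n \<Longrightarrow> C_mat \<rho>x n $$ (i, n + j) = 0"
    and "C_mat \<rho>x n $$ (n, j) = 0" "C_mat \<rho>x n $$ (n, n + j) = 0"
  using assms by (auto simp: C_mat_def Omega_mat_square mat_diag_def)

lemma C_mat_mult_vec:
  assumes v: "v \<in> carrier_vec (2 * n)"
  shows "C_mat \<rho>x n *\<^sub>v v
    = vec (n + 1) (\<lambda>i. if i < n then sqrt (1 + \<rho>x * (omega (i + 1))\<^sup>2) * v $ i else 0)"
proof (rule eq_vecI)
  fix k assume "k < dim_vec (vec (n + 1) (\<lambda>i. if i < n then sqrt (1 + \<rho>x * (omega (i + 1))\<^sup>2) * v $ i else 0))"
  hence k: "k < n + 1" by simp
  show "(C_mat \<rho>x n *\<^sub>v v) $ k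
    = vec (n + 1) (\<lambda>i. if i < n then sqrt (1 + \<rho>x * (omega (i + 1))\<^sup>2) * v $ i else 0) $ k"
    unfolding mult_mat_vec_index[OF C_mat_carrier v k] sum_two_halves
    using k by (cases "k < n") (simp_all add: C_mat_index if_zero_mult less_Suc_eq)
qed (use carrier_matD[OF C_mat_carrier[of \<rho>x n]] in simp)

lemma riccati_eq_ric:
  assumes A: "A \<in> carrier_mat n n" and B: "B \<in> carrier_mat n m" and E: "E \<in> carrier_mat n k"
    and C: "C \<in> carrier_mat l n" and P: "P \<in> carrier_mat n n"
  shows "riccati A B C E R \<gamma> P
    = ric A (- (inverse R \<cdot>\<^sub>m (B * B\<^sup>T) - inverse (\<gamma>\<^sup>2) \<cdot>\<^sub>m (E * E\<^sup>T))) (C\<^sup>T * C) P"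
proof -
  define X where "X = inverse R \<cdot>\<^sub>m (B * B\<^sup>T) - inverse (\<gamma>\<^sup>2) \<cdot>\<^sub>m (E * E\<^sup>T)"
  have "B * B\<^sup>T \<in> carrier_mat n n" "E * E\<^sup>T \<in> carrier_mat n n" using B E by auto
  hence X: "X \<in> carrier_mat n n"
    unfolding X_def by (intro minus_carrier_mat smult_carrier_mat)
  have "P * (- X) * P = - (P * X * P)" using X P by simp
  moreover have "P * A + A\<^sup>T * P - P * X * P = P * A + A\<^sup>T * P + - (P * X * P)"
    using A P X by (intro minus_add_uminus_mat[of _ n n]) auto
  ultimately show ?thesis unfolding riccati_def ric_def X_def[symmetric] by simp
qed

lemma game_matrix_quadform:
  fixes g r :: real
  assumes B: "B \<in> carrier_mat n m" and E: "E \<in> carrier_mat n k" and x: "x \<in> carrier_vec n"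
  defines "S \<equiv> - (r \<cdot>\<^sub>m (B * B\<^sup>T) - g \<cdot>\<^sub>m (E * E\<^sup>T))"
  shows "S \<in> carrier_mat n n" "S\<^sup>T = S"
    "x \<bullet> (S *\<^sub>v x) = g * ((E\<^sup>T *\<^sub>v x) \<bullet> (E\<^sup>T *\<^sub>v x)) - r * ((B\<^sup>T *\<^sub>v x) \<bullet> (B\<^sup>T *\<^sub>v (x :: real vec)))"
proof -
  have c: "B * B\<^sup>T \<in> carrier_mat n n" "E * E\<^sup>T \<in> carrier_mat n n" using B E by auto
  have t: "(B * B\<^sup>T)\<^sup>T = B * B\<^sup>T" "(E * E\<^sup>T)\<^sup>T = E * E\<^sup>T"
    using B E by (simp_all add: transpose_mult[of _ n _ _ n])
  have ts: "(h \<cdot>\<^sub>m M)\<^sup>T = h \<cdot>\<^sub>m M\<^sup>T" for M :: "real mat" and h by (rule eq_matI) auto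
  show S: "S \<in> carrier_mat n n"
    unfolding S_def by (intro uminus_carrier_mat minus_carrier_mat smult_carrier_mat c)
  show "S\<^sup>T = S" unfolding S_def using c by (simp add: transpose_uminus transpose_minus[of _ n n] ts t)
  have qB: "x \<bullet> (B * B\<^sup>T *\<^sub>v x) = (B\<^sup>T *\<^sub>v x) \<bullet> (B\<^sup>T *\<^sub>v x)"
    using transpose_mult_self_quadform[of "B\<^sup>T" m n x] B x by simp
  have qE: "x \<bullet> (E * E\<^sup>T *\<^sub>v x) = (E\<^sup>T *\<^sub>v x) \<bullet> (E\<^sup>T *\<^sub>v x)"
    using transpose_mult_self_quadform[of "E\<^sup>T" k n x] E x by simp
  have "S *\<^sub>v x = - (r \<cdot>\<^sub>v (B * B\<^sup>T *\<^sub>v x) - g \<cdot>\<^sub>v (E * E\<^sup>T *\<^sub>v x))"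
  proof -
    have "dim_vec x = dim_col (r \<cdot>\<^sub>m (B * B\<^sup>T) - g \<cdot>\<^sub>m (E * E\<^sup>T))" using E x by simp
    thus ?thesis
      unfolding S_def
      by (simp only: uminus_mult_mat_vec smult_mat_mult_vec[OF c(1) x] smult_mat_mult_vec[OF c(2) x]
          minus_mult_distrib_mat_vec[OF smult_carrier_mat[OF c(1)] smult_carrier_mat[OF c(2)] x])
  qed
  moreover have "x \<bullet> - (r \<cdot>\<^sub>v p - g \<cdot>\<^sub>v q) = g * (x \<bullet> q) - r * (x \<bullet> p)"
    if "p \<in> carrier_vec n" "q \<in> carrier_vec n" for p q
  proof -
    have "dim_vec x = dim_vec (r \<cdot>\<^sub>v p - g \<cdot>\<^sub>v q)" using x that by simp
    thus ?thesis using x that by (simp add: scalar_prod_minus_distrib[of _ n])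
  qed
  ultimately show "x \<bullet> (S *\<^sub>v x)
      = g * ((E\<^sup>T *\<^sub>v x) \<bullet> (E\<^sup>T *\<^sub>v x)) - r * ((B\<^sup>T *\<^sub>v x) \<bullet> (B\<^sup>T *\<^sub>v x))"
    using mult_mat_vec_carrier[OF c(1) x] mult_mat_vec_carrier[OF c(2) x] by (simp only: qB qE)
qed

text \<open>The Riccati form splits into the rates of the individual modes, evaluated at the common gradient
\<open>P v\<close>; only the rank-one control term couples them.\<close>

lemma beam_riccati_quadform:
  assumes P: "P \<in> carrier_mat (2 * n) (2 * n)" "P\<^sup>T = P" and v: "v \<in> carrier_vec (2 * n)" and "\<rho>x \<ge> 0"
  defines "x \<equiv> P *\<^sub>v v"
  shows "v \<bullet> (riccati (A_mat c1 c2 n) (B_mat xL xR n) (C_mat \<rho>x n) (E_mat n) R \<gamma> P *\<^sub>v v)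
    = (\<Sum>i<n. mode_rate c1 c2 \<rho>x \<gamma> (i + 1) (v $ i) (v $ (n + i)) (x $ i) (x $ (n + i)))
      - inverse R * (\<Sum>i<n. bcoef xL xR (i + 1) * x $ (n + i))\<^sup>2"
proof -
  let ?A = "A_mat c1 c2 n" and ?B = "B_mat xL xR n" and ?C = "C_mat \<rho>x n" and ?E = "E_mat n"
  let ?S = "- (inverse R \<cdot>\<^sub>m (?B * ?B\<^sup>T) - inverse (\<gamma>\<^sup>2) \<cdot>\<^sub>m (?E * ?E\<^sup>T))"
  have x: "x \<in> carrier_vec (2 * n)" using P v by (simp add: x_def)
  have Q: "?C\<^sup>T * ?C \<in> carrier_mat (2 * n) (2 * n)" using C_mat_carrier[of \<rho>x n] by auto
  have Av: "x \<bullet> (?A *\<^sub>v v) = (\<Sum>i<n. x $ i * v $ (n + i)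
      + x $ (n + i) * (- (omega (i + 1))\<^sup>2 * v $ i - (c1 + c2 * (omega (i + 1))\<^sup>2) * v $ (n + i)))"
    using scalar_prod_halves[OF mult_mat_vec_carrier[OF A_mat_carrier v], of x c1 c2]
    by (simp add: A_mat_mult_vec[OF v] sum.distrib del: index_mult_mat_vec)
  have sq: "sqrt (1 + \<rho>x * (omega k)\<^sup>2) * t * (sqrt (1 + \<rho>x * (omega k)\<^sup>2) * t)
      = (1 + \<rho>x * (omega k)\<^sup>2) * t\<^sup>2" for k t
  proof -
    have "sqrt a * t * (sqrt a * t) = (sqrt a * sqrt a) * t\<^sup>2" for a
      by (simp only: power2_eq_square mult_ac)
    thus ?thesis using \<open>\<rho>x \<ge> 0\<close> by simp
  qed
  have Cv: "v \<bullet> (?C\<^sup>T * ?C *\<^sub>v v) = (\<Sum>i<n. (1 + \<rho>x * (omega (i + 1))\<^sup>2) * (v $ i)\<^sup>2)"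
    unfolding transpose_mult_self_quadform[OF C_mat_carrier v] C_mat_mult_vec[OF v]
    by (simp add: scalar_prod_def lessThan_atLeast0[symmetric] sq)
  have Sx: "x \<bullet> (?S *\<^sub>v x) = inverse (\<gamma>\<^sup>2) * (\<Sum>i<n. (x $ (n + i))\<^sup>2)
      - inverse R * (\<Sum>i<n. bcoef xL xR (i + 1) * x $ (n + i))\<^sup>2"
    unfolding game_matrix_quadform(3)[OF B_mat_carrier E_mat_carrier x]
      B_mat_transpose_mult_vec[OF x] E_mat_transpose_mult_vec[OF x]
    by (simp add: scalar_prod_def power2_eq_square lessThan_atLeast0)
  have "v \<bullet> (ric ?A ?S (?C\<^sup>T * ?C) P *\<^sub>v v)
      = 2 * (x \<bullet> (?A *\<^sub>v v)) + x \<bullet> (?S *\<^sub>v x) + v \<bullet> (?C\<^sup>T * ?C *\<^sub>v v)"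
    unfolding x_def
    by (rule ric_quadform[OF A_mat_carrier game_matrix_quadform(1)[OF B_mat_carrier E_mat_carrier x] Q P v])
  also have "\<dots> = (\<Sum>i<n. mode_rate c1 c2 \<rho>x \<gamma> (i + 1) (v $ i) (v $ (n + i)) (x $ i) (x $ (n + i)))
      - inverse R * (\<Sum>i<n. bcoef xL xR (i + 1) * x $ (n + i))\<^sup>2"
  proof -
    have "(\<Sum>i<n. mode_rate c1 c2 \<rho>x \<gamma> (i + 1) (v $ i) (v $ (n + i)) (x $ i) (x $ (n + i)))
      = 2 * (x \<bullet> (?A *\<^sub>v v)) + v \<bullet> (?C\<^sup>T * ?C *\<^sub>v v) + inverse (\<gamma>\<^sup>2) * (\<Sum>i<n. (x $ (n + i))\<^sup>2)"
      unfolding Av Cv sum_distrib_left sum.distrib[symmetric]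
      by (intro sum.cong refl) (simp add: mode_rate_def algebra_simps)
    thus ?thesis unfolding Sx by simp
  qed
  finally show ?thesis
    unfolding riccati_eq_ric[OF A_mat_carrier B_mat_carrier E_mat_carrier C_mat_carrier P(1)] .
qed

text \<open>The output contains every position with a positive factor, and the derivative of the positions
is the vector of velocities.\<close>

lemma beam_observable:
  assumes v: "v \<in> carrier_vec (2 * n)" and "\<rho>x \<ge> 0"
    and 1: "v \<bullet> ((C_mat \<rho>x n)\<^sup>T * C_mat \<rho>x n *\<^sub>v v) = 0"
    and 2: "(A_mat c1 c2 n *\<^sub>v v) \<bullet> ((C_mat \<rho>x n)\<^sup>T * C_mat \<rho>x n *\<^sub>v (A_mat c1 c2 n *\<^sub>v v)) = 0"
  shows "v = 0\<^sub>v (2 * n)"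
proof -
  have pos: "sqrt (1 + \<rho>x * (omega (i + 1))\<^sup>2) \<noteq> 0" for i
    using \<open>\<rho>x \<ge> 0\<close> by (smt (verit) mult_nonneg_nonneg real_sqrt_eq_zero_cancel_iff zero_le_power2)
  have C0: "u $ i = 0" if u: "u \<in> carrier_vec (2 * n)"
    and 0: "u \<bullet> ((C_mat \<rho>x n)\<^sup>T * C_mat \<rho>x n *\<^sub>v u) = 0" and i: "i < n" for u i
  proof -
    have "C_mat \<rho>x n *\<^sub>v u = 0\<^sub>v (n + 1)"
      by (rule scalar_prod_self_eq_0)
        (use mult_mat_vec_carrier[OF C_mat_carrier u] 0 transpose_mult_self_quadform[OF C_mat_carrier u] in simp_all)
    hence "(C_mat \<rho>x n *\<^sub>v u) $ i = 0" using i by simp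
    thus ?thesis unfolding C_mat_mult_vec[OF u] using i pos[of i] by simp
  qed
  have z: "v $ i = 0" if "i < n" for i by (rule C0[OF v 1 that])
  have y: "v $ (n + i) = 0" if "i < n" for i
    using C0[OF mult_mat_vec_carrier[OF A_mat_carrier v] 2 that] A_mat_mult_vec(1)[OF v that] by simp
  show ?thesis
  proof (rule eq_vecI)
    fix i assume "i < dim_vec (0\<^sub>v (2 * n) :: real vec)"
    hence i: "i < 2 * n" by simp
    show "v $ i = 0\<^sub>v (2 * n) $ i"
      using z[of i] y[of "i - n"] i by (cases "i < n") auto
  qed (use v in simp)
qed

section \<open>Adding a mode\<close>

text \<open>State vectors list all positions before all velocities, so a new mode inserts one coordinate at
\<open>n\<close> and one at the end; the old coordinates are renumbered accordingly.\<close>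

definition embed_index :: "nat \<Rightarrow> nat \<Rightarrow> nat" where
  "embed_index n i = (if i < n then i else i + 1)"

definition old_modes :: "nat \<Rightarrow> real vec \<Rightarrow> real vec" where
  "old_modes n v = vec (2 * n) (\<lambda>i. v $ embed_index n i)"

lemma old_modes_index: "i < 2 * n \<Longrightarrow> old_modes n v $ i = v $ embed_index n i"
  by (simp add: old_modes_def)

text \<open>The direct sum of \<open>P\<close> and the matrix with rows \<open>a b\<close> and \<open>b c\<close>, the latter on the coordinates
\<open>n\<close> and \<open>2 n + 1\<close> of the new mode.\<close>

definition add_mode :: "nat \<Rightarrow> real mat \<Rightarrow> real \<Rightarrow> real \<Rightarrow> real \<Rightarrow> real mat" where
  "add_mode n P a b c = mat (2 * (n + 1)) (2 * (n + 1)) (\<lambda>(i, j).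
     let old = (\<lambda>k. k \<noteq> n \<and> k \<noteq> 2 * n + 1); r = (\<lambda>k. if k < n then k else k - 1) in
     if old i \<and> old j then P $$ (r i, r j)
     else if i = n \<and> j = n then a
     else if i = 2 * n + 1 \<and> j = 2 * n + 1 then c
     else if old i \<or> old j then 0 else b)"

lemma sum_modes_Suc:
  fixes f :: "nat \<Rightarrow> real"
  shows "(\<Sum>j<2 * (n + 1). f j) = (\<Sum>j<2 * n. f (embed_index n j)) + f n + f (2 * n + 1)"
  unfolding sum_two_halves by (simp add: embed_index_def mult_2)

lemma add_mode_carrier [simp]: "add_mode n P a b c \<in> carrier_mat (2 * (n + 1)) (2 * (n + 1))"
  by (simp add: add_mode_def)

lemma add_mode_symmetric:
  assumes "P \<in> carrier_mat (2 * n) (2 * n)" "P\<^sup>T = P"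
  shows "(add_mode n P a b c)\<^sup>T = add_mode n P a b c"
proof -
  have sym: "P $$ (i, j) = P $$ (j, i)" if "i < 2 * n" "j < 2 * n" for i j
    using assms that by (metis carrier_matD index_transpose_mat(1))
  show ?thesis
    by (rule eq_matI) (auto simp: add_mode_def Let_def intro!: sym)
qed

lemma add_mode_mult_vec:
  assumes P: "P \<in> carrier_mat (2 * n) (2 * n)" and v: "v \<in> carrier_vec (2 * (n + 1))"
  shows "i < 2 * n \<Longrightarrow> (add_mode n P a b c *\<^sub>v v) $ embed_index n i = (P *\<^sub>v old_modes n v) $ i"
    and "(add_mode n P a b c *\<^sub>v v) $ n = a * v $ n + b * v $ (2 * n + 1)"
    and "(add_mode n P a b c *\<^sub>v v) $ (2 * n + 1) = b * v $ n + c * v $ (2 * n + 1)"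
proof -
  have old: "old_modes n v \<in> carrier_vec (2 * n)" by (simp add: old_modes_def)
  show "(add_mode n P a b c *\<^sub>v v) $ embed_index n i = (P *\<^sub>v old_modes n v) $ i" if i: "i < 2 * n"
  proof -
    have "embed_index n i < 2 * (n + 1)" using i by (simp add: embed_index_def)
    thus ?thesis
      unfolding mult_mat_vec_index[OF P old i] mult_mat_vec_index[OF add_mode_carrier v \<open>embed_index n i < 2 * (n + 1)\<close>]
        sum_modes_Suc
      using i by (auto simp: add_mode_def Let_def old_modes_def embed_index_def intro!: sum.cong)
  qed
  have n: "n < 2 * (n + 1)" "2 * n + 1 < 2 * (n + 1)" by auto
  show "(add_mode n P a b c *\<^sub>v v) $ n = a * v $ n + b * v $ (2 * n + 1)"
    "(add_mode n P a b c *\<^sub>v v) $ (2 * n + 1) = b * v $ n + c * v $ (2 * n + 1)"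
    unfolding mult_mat_vec_index[OF add_mode_carrier v n(1)] mult_mat_vec_index[OF add_mode_carrier v n(2)] sum_modes_Suc
    by (auto simp: add_mode_def Let_def embed_index_def intro!: sum.neutral)
qed

lemma psd_add_mode:
  assumes P: "psd (2 * n) P" and abc: "\<And>z y. 0 \<le> a * z\<^sup>2 + 2 * b * z * y + c * y\<^sup>2"
  shows "psd (2 * (n + 1)) (add_mode n P a b c)"
  unfolding psd_def
proof (intro conjI ballI add_mode_carrier)
  have Pc: "P \<in> carrier_mat (2 * n) (2 * n)" "P\<^sup>T = P" using P by (auto simp: psd_def)
  show "(add_mode n P a b c)\<^sup>T = add_mode n P a b c" by (rule add_mode_symmetric[OF Pc])
  fix v :: "real vec" assume v: "v \<in> carrier_vec (2 * (n + 1))"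
  have old: "old_modes n v \<in> carrier_vec (2 * n)" by (simp add: old_modes_def)
  let ?x = "add_mode n P a b c *\<^sub>v v"
  have "v \<bullet> ?x = (\<Sum>j<2 * (n + 1). v $ j * ?x $ j)"
    by (simp add: scalar_prod_def lessThan_atLeast0 add_mode_def del: index_mult_mat_vec)
  also have "\<dots> = old_modes n v \<bullet> (P *\<^sub>v old_modes n v)
      + (a * (v $ n)\<^sup>2 + 2 * b * v $ n * v $ (2 * n + 1) + c * (v $ (2 * n + 1))\<^sup>2)"
  proof -
    have "old_modes n v \<bullet> (P *\<^sub>v old_modes n v)
        = (\<Sum>j<2 * n. v $ embed_index n j * (P *\<^sub>v old_modes n v) $ j)"
      using Pc(1) by (simp add: scalar_prod_def[of "old_modes n v"] lessThan_atLeast0 old_modes_index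
          del: index_mult_mat_vec)
    also have "\<dots> = (\<Sum>j<2 * n. v $ embed_index n j * ?x $ embed_index n j)"
      by (intro sum.cong refl) (simp only: lessThan_iff add_mode_mult_vec(1)[OF Pc(1) v])
    finally show ?thesis unfolding sum_modes_Suc add_mode_mult_vec(2,3)[OF Pc(1) v]
      by (simp add: power2_eq_square algebra_simps)
  qed
  finally show "0 \<le> v \<bullet> ?x" using P old abc by (simp add: psd_def)
qed

text \<open>The equation for \<open>P\<close> says that the old modes' rates add up to \<open>s\<^sup>2 / R\<close>.  Only this value, the
rate of the new mode and the new control term are left, which is what \<open>control_exchange\<close> estimates.\<close>

lemma add_mode_riccati_quadform:
  assumes P: "P \<in> carrier_mat (2 * n) (2 * n)" "P\<^sup>T = P" and v: "v \<in> carrier_vec (2 * (n + 1))" and "\<rho>x \<ge> 0"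
    and ric0: "riccati (A_mat c1 c2 n) (B_mat xL xR n) (C_mat \<rho>x n) (E_mat n) R \<gamma> P = 0\<^sub>m (2 * n) (2 * n)"
  defines "z \<equiv> v $ n" and "y \<equiv> v $ (2 * n + 1)"
  defines "s \<equiv> \<Sum>i<n. bcoef xL xR (i + 1) * (P *\<^sub>v old_modes n v) $ (n + i)"
  shows "v \<bullet> (riccati (A_mat c1 c2 (n + 1)) (B_mat xL xR (n + 1)) (C_mat \<rho>x (n + 1)) (E_mat (n + 1)) R' \<gamma>
      (add_mode n P a b c) *\<^sub>v v)
    = inverse R * s\<^sup>2 + mode_rate c1 c2 \<rho>x \<gamma> (n + 1) z y (a * z + b * y) (b * z + c * y)
      - inverse R' * (s + bcoef xL xR (n + 1) * (b * z + c * y))\<^sup>2"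
proof -
  let ?x = "add_mode n P a b c *\<^sub>v v" and ?w = "old_modes n v"
  have old: "?w \<in> carrier_vec (2 * n)" by (simp add: old_modes_def)
  have "0 = ?w \<bullet> (0\<^sub>m (2 * n) (2 * n) *\<^sub>v ?w)"
  proof -
    have "0\<^sub>m (2 * n) (2 * n) *\<^sub>v ?w = 0\<^sub>v (2 * n)" using old by (intro eq_vecI) auto
    thus ?thesis using old by simp
  qed
  also have "\<dots> = (\<Sum>i<n. mode_rate c1 c2 \<rho>x \<gamma> (i + 1) (?w $ i) (?w $ (n + i)) ((P *\<^sub>v ?w) $ i) ((P *\<^sub>v ?w) $ (n + i)))
      - inverse R * s\<^sup>2"
    unfolding ric0[symmetric] s_def by (rule beam_riccati_quadform[OF P old \<open>\<rho>x \<ge> 0\<close>])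
  finally have old_sum: "(\<Sum>i<n. mode_rate c1 c2 \<rho>x \<gamma> (i + 1) (?w $ i) (?w $ (n + i))
      ((P *\<^sub>v ?w) $ i) ((P *\<^sub>v ?w) $ (n + i))) = inverse R * s\<^sup>2" by simp
  have low: "?x $ i = (P *\<^sub>v ?w) $ i" "v $ i = ?w $ i" if "i < n" for i
    using add_mode_mult_vec(1)[OF P(1) v, of i a b c] that by (simp_all add: embed_index_def old_modes_def)
  have high: "?x $ (n + 1 + i) = (P *\<^sub>v ?w) $ (n + i)" "v $ (n + 1 + i) = ?w $ (n + i)" if "i < n" for i
    using add_mode_mult_vec(1)[OF P(1) v, of "n + i" a b c] that by (simp_all add: embed_index_def old_modes_def)
  have last: "n + 1 + n = 2 * n + 1" by simp
  have split: "(\<Sum>i<n + 1. f i) = (\<Sum>i<n. f i) + f n" for f :: "nat \<Rightarrow> real" by simp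
  have 1: "(\<Sum>i<n + 1. mode_rate c1 c2 \<rho>x \<gamma> (i + 1) (v $ i) (v $ (n + 1 + i)) (?x $ i) (?x $ (n + 1 + i)))
      = inverse R * s\<^sup>2 + mode_rate c1 c2 \<rho>x \<gamma> (n + 1) z y (a * z + b * y) (b * z + c * y)"
    unfolding split last add_mode_mult_vec(2,3)[OF P(1) v] old_sum[symmetric] z_def[symmetric] y_def[symmetric]
    by (intro arg_cong2[where f = "(+)"] sum.cong refl) (simp only: lessThan_iff low high)
  have 2: "(\<Sum>i<n + 1. bcoef xL xR (i + 1) * ?x $ (n + 1 + i)) = s + bcoef xL xR (n + 1) * (b * z + c * y)"
    unfolding split last add_mode_mult_vec(3)[OF P(1) v] s_def z_def[symmetric] y_def[symmetric]
    by (intro arg_cong2[where f = "(+)"] sum.cong refl) (simp only: lessThan_iff high)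
  show ?thesis
    unfolding beam_riccati_quadform[OF add_mode_carrier add_mode_symmetric[OF P] v \<open>\<rho>x \<ge> 0\<close>] 1 2 ..
qed

theorem mainTheorem2:
  fixes c1 c2 xL xR \<rho>x \<rho>u \<gamma> :: real and N :: nat
  assumes "c1 > 0" and "c2 > 0" and "c1 + c2 \<le> sqrt 2"
    and "0 < xL" and "xL < xR" and "xR < pi"
    and "\<rho>x \<ge> 0" and "\<rho>u \<ge> 0"
    and "N \<ge> 1" and "\<gamma> > 0"
    and "achievable c1 c2 xL xR \<rho>x \<rho>u \<gamma> N"
  shows "achievable c1 c2 xL xR \<rho>x \<rho>u \<gamma> (N + 1)"
proof -
  define R where "R = \<rho>u + rho_inf c1 c2 xL xR \<rho>x \<gamma> N"
  define R' where "R' = \<rho>u + rho_inf c1 c2 xL xR \<rho>x \<gamma> (N + 1)"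
  have den: "denoms_pos c1 c2 \<rho>x \<gamma> N" using assms by (simp add: achievable_def denoms_pos_def)
  obtain P where P: "sym_pos_def (2 * N) P"
    and ric0: "riccati (A_mat c1 c2 N) (B_mat xL xR N) (C_mat \<rho>x N) (E_mat N) R \<gamma> P = 0\<^sub>m (2 * N) (2 * N)"
    using assms by (auto simp: achievable_def R_def)
  note step = rho_inf_step[OF assms(1-3) den assms(7,4-6)]
  have R: "R > 0" using rho_inf_pos[OF den assms(7,4-6)] assms(8) by (simp add: R_def)
  have R': "R' > 0" using rho_inf_pos[OF step(1) assms(7,4-6)] assms(8) by (simp add: R'_def)
  have RR': "rho c1 c2 xL xR \<rho>x \<gamma> (N + 1) + R' \<le> R" using step(3) by (simp add: R_def R'_def)
  have Ppsd: "psd (2 * N) P"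
    unfolding psd_def
  proof (intro conjI ballI)
    fix v :: "real vec" assume v: "v \<in> carrier_vec (2 * N)"
    thus "0 \<le> v \<bullet> (P *\<^sub>v v)"
      using P by (cases "v = 0\<^sub>v (2 * N)") (auto simp: sym_pos_def_def less_imp_le)
  qed (use P in \<open>auto simp: sym_pos_def_def\<close>)
  hence Pc: "P \<in> carrier_mat (2 * N) (2 * N)" "P\<^sup>T = P" by (auto simp: psd_def)
  obtain a b c where abc: "\<And>z y. 0 \<le> a * z\<^sup>2 + 2 * b * z * y + c * y\<^sup>2"
    "\<And>z y u. mode_rate c1 c2 \<rho>x \<gamma> (N + 1) z y (a * z + b * y) (b * z + c * y)
        + 2 * (bcoef xL xR (N + 1) * (b * z + c * y)) * u - rho c1 c2 xL xR \<rho>x \<gamma> (N + 1) * u\<^sup>2 \<le> 0"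
    using single_mode_storage[OF assms(1,2,7) le_add2 step(2), of xL xR] by blast
  define X where "X = add_mode N P a b c"
  let ?n = "2 * (N + 1)"
  let ?A = "A_mat c1 c2 (N + 1)" and ?B = "B_mat xL xR (N + 1)"
  let ?C = "C_mat \<rho>x (N + 1)" and ?E = "E_mat (N + 1)"
  let ?S = "- (inverse R' \<cdot>\<^sub>m (?B * ?B\<^sup>T) - inverse (\<gamma>\<^sup>2) \<cdot>\<^sub>m (?E * ?E\<^sup>T))"
  have X: "psd ?n X" unfolding X_def by (rule psd_add_mode[OF Ppsd abc(1)])
  have eq: "riccati ?A ?B ?C ?E R' \<gamma> M = ric ?A ?S (?C\<^sup>T * ?C) M" if "M \<in> carrier_mat ?n ?n" for M
    by (rule riccati_eq_ric[OF A_mat_carrier B_mat_carrier E_mat_carrier C_mat_carrier that])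
  have "v \<bullet> (riccati ?A ?B ?C ?E R' \<gamma> X *\<^sub>v v) \<le> 0" if v: "v \<in> carrier_vec ?n" for v
    unfolding X_def add_mode_riccati_quadform[OF Pc v assms(7) ric0]
    by (rule control_exchange[OF R' RR' R]) (rule abc(2))
  hence le: "v \<bullet> (ric ?A ?S (?C\<^sup>T * ?C) X *\<^sub>v v) \<le> 0" if "v \<in> carrier_vec ?n" for v
    using that X eq[of X] by (simp add: psd_def)
  obtain P' where P': "sym_pos_def ?n P'" "ric ?A ?S (?C\<^sup>T * ?C) P' = 0\<^sub>m ?n ?n"
  proof (rule riccati_inequality_imp_equation[OF A_mat_carrier
        game_matrix_quadform(1,2)[OF B_mat_carrier E_mat_carrier zero_carrier_vec]
        psd_transpose_mult_self[OF C_mat_carrier] beam_observable X le])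
  qed (use assms(7) in auto)
  have "riccati ?A ?B ?C ?E R' \<gamma> P' = 0\<^sub>m ?n ?n"
    using P' eq[of P'] by (simp add: sym_pos_def_def)
  thus ?thesis using P'(1) step(1) unfolding achievable_def denoms_pos_def R'_def by blast
qed

end
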